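(* Let $L>0$ and $\epsilon>0$ be any two positive real numbers. Let $R=L\sqrt{\frac{2}{3}+\frac{1}{\sqrt{3}}}$ and let $\Omega=B_R(0,0)=\{(x,y)\in\mathbb{R}^2: x^2+y^2<R^2\}$. Let $$ \mathbf{E}_1=\epsilon\begin{pmatrix}1&0\\0&-1\end{pmatrix},\qquad \mathbf{E}_2=\epsilon\begin{pmatrix}-\frac12&\frac{\sqrt3}{2}\\ \frac{\sqrt3}{2}&\frac12\end{pmatrix},\qquad \mathbf{E}_3=\epsilon\begin{pmatrix}-\frac12&-\frac{\sqrt3}{2}\\ -\frac{\sqrt3}{2}&\frac12\end{pmatrix}. $$ Then there exists a map $\mathbf{u}:\Omega\to\mathbb{R}^2$ such that: 1) $\mathbf{u}$ is continuous in $\overline{\Omega}$, i.e. $\mathbf{u}\in C(\overline{\Omega},\mathbb{R}^2)$; 2) $\bigl(\nabla\mathbf{u}(x,y)\bigr)_{sym}\in\{\mathbf{E}_1,\mathbf{E}_2,\mathbf{E}_3\}$ for a.e. $(x,y)$ in $\Omega$; 3) $\mathcal{L}^2(\omega_{\mathbf{E}_i})=\frac{\pi}{3}R^2$ for $i=1,2,3$, where $\omega_{\mathbf{E}_i}:=\{(x,y)\in\Omega:(\nabla\mathbf{u}(x,y))_{sym}=\mathbf{E}_i\}$; 4) $\mathbf{u}$ lies in (an equivalence class in) $W^{1,p}(\Omega,\mathbb{R}^2)$ for every $1\le p<\infty$, and $\mathbf{u}$ is not Lipschitz continuous in $\Omega$.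
   Context: For a map $\mathbf{u}=(u_1,u_2):\Omega\to\mathbb{R}^2$, $\nabla\mathbf{u}$ denotes its (weak) gradient, the $2\times2$ matrix field with entries $(\nabla\mathbf{u})_{ij}=\partial u_i/\partial x_j$, where $x_1=x$, $x_2=y$. For a square matrix $\mathbf{M}$, $\mathbf{M}_{sym}:=(\mathbf{M}+\mathbf{M}^T)/2$ is its symmetric part. $\mathcal{L}^2$ is the two-dimensional Lebesgue measure. $C(\overline{\Omega},\mathbb{R}^2)$ denotes the continuous vector fields on $\Omega$ that are continuous on the closure $\overline{\Omega}$ (for a map defined on the open set $\Omega$: that extend continuously to $\overline{\Omega}$). $W^{1,p}(\Omega,\mathbb{R}^2)$ is the Sobolev space of vector-valued $L^p$ functions whose weak gradient has $L^p$-integrable components. *)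

theory Defs
  imports "HOL-Analysis.Analysis"
begin

definition partial_deriv :: "'n::finite \<Rightarrow> (real^'n \<Rightarrow> real) \<Rightarrow> real^'n \<Rightarrow> real" where
  "partial_deriv j f x = frechet_derivative f (at x) (axis j 1)"

(* C^k on the whole space; differentiability at each level ensures that the value of
   frechet_derivative is meaningful. *)
primrec Ck :: "nat \<Rightarrow> (real^'n::finite \<Rightarrow> real) \<Rightarrow> bool" where
  "Ck 0 f = continuous_on UNIV f"
| "Ck (Suc k) f = ((\<forall>x. f differentiable (at x)) \<and> (\<forall>j. Ck k (partial_deriv j f)))"

(* Test functions on \<Omega> are represented by their extension by zero to the whole space. *)
definition test_function :: "(real^'n::finite) set \<Rightarrow> (real^'n \<Rightarrow> real) \<Rightarrow> bool" where
  "test_function \<Omega> \<phi> \<longleftrightarrow>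
     (\<forall>k. Ck k \<phi>) \<and> compact (closure {x. \<phi> x \<noteq> 0}) \<and> closure {x. \<phi> x \<noteq> 0} \<subseteq> \<Omega>"

definition locally_integrable :: "(real^'n::finite) set \<Rightarrow> (real^'n \<Rightarrow> real) \<Rightarrow> bool" where
  "locally_integrable \<Omega> f \<longleftrightarrow> (\<forall>K. compact K \<and> K \<subseteq> \<Omega> \<longrightarrow> set_integrable lebesgue K f)"

definition has_weak_partial ::
  "(real^'n::finite) set \<Rightarrow> 'n \<Rightarrow> (real^'n \<Rightarrow> real) \<Rightarrow> (real^'n \<Rightarrow> real) \<Rightarrow> bool" where
  "has_weak_partial \<Omega> j f g \<longleftrightarrow>
     locally_integrable \<Omega> f \<and> locally_integrable \<Omega> g \<and>
     (\<forall>\<phi>. test_function \<Omega> \<phi> \<longrightarrow>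
        (LINT x:\<Omega>|lebesgue. f x * partial_deriv j \<phi> x) = - (LINT x:\<Omega>|lebesgue. g x * \<phi> x))"

(* A relation, since the weak gradient is determined only up to a null set; row i of G is the
   weak gradient of the i-th component of u. *)
definition has_weak_gradient ::
  "(real^'n::finite) set \<Rightarrow> (real^'n \<Rightarrow> real^'m::finite) \<Rightarrow> (real^'n \<Rightarrow> real^'n^'m) \<Rightarrow> bool" where
  "has_weak_gradient \<Omega> u G \<longleftrightarrow>
     (\<forall>i j. has_weak_partial \<Omega> j (\<lambda>x. u x $ i) (\<lambda>x. G x $ i $ j))"

definition in_Lp ::
  "real \<Rightarrow> (real^'n::finite) set \<Rightarrow> (real^'n \<Rightarrow> 'b::euclidean_space) \<Rightarrow> bool" where
  "in_Lp p \<Omega> f \<longleftrightarrow>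
     f \<in> borel_measurable (lebesgue_on \<Omega>) \<and>
     integrable (lebesgue_on \<Omega>) (\<lambda>x. norm (f x) powr p)"

(* Functions rather than equivalence classes; the predicate is invariant under modification
   of u on a null set. *)
definition in_W1p ::
  "real \<Rightarrow> (real^'n::finite) set \<Rightarrow> (real^'n \<Rightarrow> real^'m::finite) \<Rightarrow> bool" where
  "in_W1p p \<Omega> u \<longleftrightarrow>
     in_Lp p \<Omega> u \<and>
     (\<exists>G. has_weak_gradient \<Omega> u G \<and> (\<forall>i j. in_Lp p \<Omega> (\<lambda>x. G x $ i $ j)))"

(* Only the values of u on \<Omega> matter: u restricted to \<Omega> extends continuously to the closure. *)
definition continuous_up_to_closure ::
  "'a::topological_space set \<Rightarrow> ('a \<Rightarrow> 'b::topological_space) \<Rightarrow> bool" where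
  "continuous_up_to_closure \<Omega> u \<longleftrightarrow>
     (\<exists>v. continuous_on (closure \<Omega>) v \<and> (\<forall>x\<in>\<Omega>. v x = u x))"

definition sym_part :: "real^'n^'n::finite \<Rightarrow> real^'n^'n" where
  "sym_part M = (1/2) *\<^sub>R (M + transpose M)"

end

theory Submission
  imports Defs "HOL-Real_Asymp.Real_Asymp"
begin

text \<open>
  Let \<open>T\<close> be an equilateral triangle whose sides have normals \<open>n\<^sub>1, n\<^sub>2, n\<^sub>3\<close> at angles
  \<open>-45, 75, 195\<close> degrees, and let \<open>T' = -\<lambda> T\<close> with \<open>\<lambda> = 2 - sqrt 3\<close>. The six triangles
  spanned by the vertices of \<open>T\<close> and of \<open>T'\<close> triangulate \<open>T - T'\<close>, and for exactly this value of \<open>\<lambda>\<close>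
  all their edges are compatible with the three wells: the piecewise affine \<open>v\<close> that vanishes on the
  boundary of \<open>T\<close> and equals the infinitesimal rotation \<open>v(x, y) = \<epsilon> sqrt 3 (y, -x)\<close> on \<open>T'\<close> has its
  symmetrised gradient in the wells throughout \<open>T - T'\<close>. As a half turn preserves strains, the sum
  \<open>u(x) = \<Sum>\<^sub>k \<mu>\<^sub>k v(x / \<mu>\<^sub>k)\<close> with \<open>\<mu>\<^sub>k = \<rho> (-\<lambda>)\<^sup>k\<close> refines \<open>v\<close> inside \<open>T'\<close> and has its strain in the wells
  almost everywhere on \<open>\<rho> T\<close>, while each layer adds a fixed rotation. The gradient thus grows
  logarithmically at the origin: it lies in every \<open>L\<^sup>p\<close>, but \<open>u\<close> is not Lipschitz. The construction commutes
  with the rotation by 120 degrees, which permutes the wells, so the three phases have equal area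
  in every centred ball inside \<open>\<rho> T\<close>.
\<close>

section \<open>Weak derivatives of Lipschitz functions\<close>

lemma integrable_const_cball:
  "integrable lebesgue (\<lambda>x::'a::euclidean_space. K * indicator (cball 0 r) x :: real)"
proof -
  have "emeasure lebesgue (cball 0 r :: 'a set) < \<infinity>"
    using fmeasurableD2[OF lmeasurable_cball] by (simp add: top.not_eq_extremum)
  then show ?thesis
    by (intro integrable_mult_right integrable_real_indicator) auto
qed

lemma abs_mult_Suc_le: "\<bar>a\<bar> \<le> C * (1 / real (Suc n)) \<Longrightarrow> \<bar>a * real (Suc n)\<bar> \<le> C"
  by (simp add: abs_mult field_simps del: of_nat_Suc)

lemma integrable_bounded_support:
  fixes f :: "real^'n::finite \<Rightarrow> real"
  assumes "f \<in> borel_measurable lebesgue" "\<And>x. norm x > r \<Longrightarrow> f x = 0" "AE x in lebesgue. \<bar>f x\<bar> \<le> B"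
  shows "integrable lebesgue f"
proof (rule Bochner_Integration.integrable_bound)
  show "integrable lebesgue (\<lambda>x::real^'n. B * indicator (cball 0 r) x :: real)"
    by (rule integrable_const_cball)
  show "AE x in lebesgue. norm (f x) \<le> norm (B * indicator (cball 0 r) x)"
    using assms(3) by eventually_elim (use assms(2) in \<open>auto simp: indicator_def abs_le_iff\<close>)
qed (use assms in auto)

lemma partial_deriv_eq:
  assumes "(f has_derivative D) (at x)"
  shows "partial_deriv j f x = D (axis j 1)"
  unfolding partial_deriv_def using frechet_derivative_at[OF assms] by simp

lemma has_derivative_axis:
  fixes f :: "real^'n::finite \<Rightarrow> real"
  assumes "(f has_derivative D) (at x)"
  shows "((\<lambda>t. f (x + t *\<^sub>R axis j 1)) has_real_derivative D (axis j 1)) (at 0)"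
proof -
  have D: "linear D" using assms has_derivative_linear by blast
  have "((\<lambda>t::real. x + t *\<^sub>R axis j 1) has_derivative (\<lambda>t. t *\<^sub>R axis j 1)) (at 0)"
    by (auto intro!: derivative_eq_intros)
  then have "((\<lambda>t::real. f (x + t *\<^sub>R axis j 1)) has_derivative (\<lambda>t. D (t *\<^sub>R axis j 1))) (at 0)"
    by (rule has_derivative_compose) (use assms in simp)
  then show ?thesis
    unfolding has_field_derivative_def
    by (rule has_derivative_eq_rhs) (auto simp: fun_eq_iff linear_scale[OF D])
qed

lemma difference_quotient_tendsto:
  fixes f :: "real^'n::finite \<Rightarrow> real"
  assumes "(f has_derivative D) (at x)"
  shows "(\<lambda>n. (f (x + (1 / real (Suc n)) *\<^sub>R axis j 1) - f x) * real (Suc n)) \<longlonglongrightarrow> D (axis j 1)"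
proof -
  have "((\<lambda>t. (f (x + t *\<^sub>R axis j 1) - f x) / t) \<longlongrightarrow> D (axis j 1)) (at 0)"
    using has_derivative_axis[OF assms, of j] by (simp add: has_field_derivative_def DERIV_def
        flip: has_field_derivative_def)
  moreover have "filterlim (\<lambda>n. 1 / real (Suc n)) (at 0) sequentially"
    unfolding filterlim_at by (intro conjI LIMSEQ_Suc[OF lim_1_over_n] always_eventually) auto
  ultimately have "(\<lambda>n. (f (x + (1 / real (Suc n)) *\<^sub>R axis j 1) - f x) / (1 / real (Suc n))) \<longlonglongrightarrow> D (axis j 1)"
    by (rule filterlim_compose)
  then show ?thesis by simp
qed

section \<open>Test functions\<close>

lemma test_function_derivative:
  assumes "test_function \<Omega> \<phi>"
  shows "(\<phi> has_derivative frechet_derivative \<phi> (at x)) (at x)"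
    and "continuous_on UNIV \<phi>" "continuous_on UNIV (partial_deriv j \<phi>)"
proof -
  have "Ck 0 \<phi>" "Ck (Suc 0) \<phi>" using assms unfolding test_function_def by auto
  then show "(\<phi> has_derivative frechet_derivative \<phi> (at x)) (at x)"
    "continuous_on UNIV \<phi>" "continuous_on UNIV (partial_deriv j \<phi>)"
    by (auto simp: frechet_derivative_works)
qed

lemma test_function_outside:
  fixes \<phi> :: "real^'n::finite \<Rightarrow> real"
  assumes "test_function \<Omega> \<phi>" "x \<notin> closure {x. \<phi> x \<noteq> 0}"
  shows "\<phi> x = 0" "partial_deriv j \<phi> x = 0"
proof -
  let ?U = "- closure {x. \<phi> x \<noteq> 0}"
  have *: "\<phi> y = 0" if "y \<in> ?U" for y
    using that closure_subset[of "{x. \<phi> x \<noteq> 0}"] by auto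
  from *[of x] show "\<phi> x = 0" using assms(2) by blast
  have "(\<phi> has_derivative (\<lambda>h. 0)) (at x)"
  proof (rule has_derivative_transform_within_open)
    show "((\<lambda>_. 0) has_derivative (\<lambda>h. 0)) (at x)" "open ?U" by auto
    show "x \<in> ?U" using assms(2) by blast
  qed (simp only: *)
  from partial_deriv_eq[OF this] show "partial_deriv j \<phi> x = 0" by simp
qed

lemma test_function_bounds:
  fixes \<phi> :: "real^'n::finite \<Rightarrow> real"
  assumes "test_function \<Omega> \<phi>"
  obtains r B where "r > 0" "B \<ge> 0" "\<And>x. norm x > r \<Longrightarrow> \<phi> x = 0" "\<And>x. norm x > r \<Longrightarrow> partial_deriv j \<phi> x = 0"
    "\<And>x. \<bar>\<phi> x\<bar> \<le> B" "\<And>x. \<bar>partial_deriv j \<phi> x\<bar> \<le> B"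
proof -
  let ?S = "closure {x. \<phi> x \<noteq> 0}"
  have S: "compact ?S" using assms unfolding test_function_def by auto
  then obtain r where r: "r > 0" "\<forall>x\<in>?S. norm x \<le> r"
    using compact_imp_bounded bounded_pos by metis
  have "bounded (\<phi> ` ?S)" "bounded (partial_deriv j \<phi> ` ?S)"
    using S test_function_derivative(2)[OF assms] test_function_derivative(3)[OF assms, of j]
    by (auto intro!: compact_imp_bounded compact_continuous_image intro: continuous_on_subset)
  then obtain B1 B2 where B: "B1 > 0" "\<forall>x\<in>?S. \<bar>\<phi> x\<bar> \<le> B1" "B2 > 0" "\<forall>x\<in>?S. \<bar>partial_deriv j \<phi> x\<bar> \<le> B2"
    unfolding bounded_pos by (auto simp del: not_le)
  have out: "\<phi> x = 0" "partial_deriv j \<phi> x = 0" if "norm x > r" for x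
  proof -
    have "x \<notin> ?S" using r(2) that by (meson leD)
    then show "\<phi> x = 0" "partial_deriv j \<phi> x = 0"
      by (rule test_function_outside[OF assms])+
  qed
  show thesis
  proof (rule that[of r "B1 + B2"])
    show "\<bar>\<phi> x\<bar> \<le> B1 + B2" for x
      using B test_function_outside(1)[OF assms, of x] by (cases "x \<in> ?S") force+
    show "\<bar>partial_deriv j \<phi> x\<bar> \<le> B1 + B2" for x
      using B test_function_outside(2)[OF assms, of x j] by (cases "x \<in> ?S") force+
  qed (use B r out in auto)
qed

text \<open>Off \<open>\<Omega>\<close> the test function and its derivative vanish, so all
  integrals can be taken over the whole space, where translation invariance applies.\<close>

lemma test_function_set_integral:
  assumes "test_function \<Omega> \<phi>"
  shows "(LINT x:\<Omega>|lebesgue. f x * partial_deriv j \<phi> x) = (LINT x|lebesgue. f x * partial_deriv j \<phi> x)"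
    and "(LINT x:\<Omega>|lebesgue. f x * \<phi> x) = (LINT x|lebesgue. f x * \<phi> x)"
proof -
  have "\<phi> x = 0 \<and> partial_deriv j \<phi> x = 0" if "x \<notin> \<Omega>" for x
    using test_function_outside(1)[OF assms, of x] test_function_outside(2)[OF assms, of x j] that assms
    unfolding test_function_def by blast
  then show "(LINT x:\<Omega>|lebesgue. f x * partial_deriv j \<phi> x) = (LINT x|lebesgue. f x * partial_deriv j \<phi> x)"
    "(LINT x:\<Omega>|lebesgue. f x * \<phi> x) = (LINT x|lebesgue. f x * \<phi> x)"
    unfolding set_lebesgue_integral_def by (auto intro!: Bochner_Integration.integral_cong simp: indicator_def)
qed

lemma test_function_lipschitz_axis:
  fixes \<phi> :: "real^'n::finite \<Rightarrow> real"
  assumes "test_function \<Omega> \<phi>" "\<And>x. \<bar>partial_deriv j \<phi> x\<bar> \<le> B" "h \<ge> 0"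
  shows "\<bar>\<phi> (x + h *\<^sub>R axis j 1) - \<phi> x\<bar> \<le> B * h"
proof -
  have D: "((\<lambda>t. \<phi> (x + t *\<^sub>R axis j 1)) has_real_derivative partial_deriv j \<phi> (x + t *\<^sub>R axis j 1)) (at t)" for t
  proof -
    have "((\<lambda>s. \<phi> ((x + t *\<^sub>R axis j 1) + s *\<^sub>R axis j 1)) has_real_derivative partial_deriv j \<phi> (x + t *\<^sub>R axis j 1)) (at 0)"
      using has_derivative_axis[OF test_function_derivative(1)[OF assms(1)]]
      unfolding partial_deriv_def .
    then show ?thesis by (subst DERIV_shift[of _ _ 0 t, simplified]) (simp add: algebra_simps)
  qed
  have "norm (\<phi> (x + h *\<^sub>R axis j 1) - \<phi> (x + 0 *\<^sub>R axis j 1)) \<le> B * norm (h - 0)"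
    by (rule field_differentiable_bound[where S=UNIV, OF _ DERIV_subset[OF D]]) (use assms in auto)
  then show ?thesis using assms(3) by simp
qed

lemma lborel_integral_translation:
  fixes f :: "'a::euclidean_space \<Rightarrow> real"
  assumes [measurable]: "f \<in> borel_measurable borel"
  shows "(LINT x|lborel. f (x + c)) = (LINT x|lborel. f x)"
proof -
  have "(LINT x|lborel. f x) = (LINT x|distr lborel borel ((+) c). f x)"
    by (simp add: lborel_distr_plus)
  also have "\<dots> = (LINT x|lborel. f (x + c))"
    by (subst integral_distr) (simp_all add: add.commute)
  finally show ?thesis ..
qed

lemma lipschitz_partial_bound:
  fixes f :: "real^'n::finite \<Rightarrow> real"
  assumes "C-lipschitz_on UNIV f" "(f has_derivative D) (at x)"
  shows "\<bar>D (axis j 1)\<bar> \<le> C"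
proof -
  have "(\<lambda>n. \<bar>(f (x + (1 / real (Suc n)) *\<^sub>R axis j 1) - f x) * real (Suc n)\<bar>) \<longlonglongrightarrow> \<bar>D (axis j 1)\<bar>"
    by (rule tendsto_rabs[OF difference_quotient_tendsto[OF assms(2)]])
  moreover have "\<bar>(f (x + (1 / real (Suc n)) *\<^sub>R axis j 1) - f x) * real (Suc n)\<bar> \<le> C" for n
    using lipschitz_onD[OF assms(1), of "x + (1 / real (Suc n)) *\<^sub>R axis j 1" x]
    by (intro abs_mult_Suc_le) (simp add: dist_norm)
  ultimately show ?thesis using LIMSEQ_le_const2 by blast
qed

text \<open>Almost everywhere \<open>g\<close> is the limit of difference quotients of
  \<open>f\<close>, which are Borel; completeness of \<open>lebesgue\<close> absorbs the exceptional
  null set.\<close>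

lemma partial_measurable:
  fixes f :: "real^'n::finite \<Rightarrow> real"
  assumes "continuous_on UNIV f"
    and ae: "AE x in lebesgue. \<exists>D. (f has_derivative D) (at x) \<and> g x = D (axis j 1)"
  shows "g \<in> borel_measurable lebesgue"
proof -
  let ?q = "\<lambda>n x. (f (x + (1 / real (Suc n)) *\<^sub>R axis j 1) - f x) * real (Suc n)"
  have [measurable]: "f \<in> borel_measurable borel"
    using assms(1) by (rule borel_measurable_continuous_onI)
  have q: "?q n \<in> borel_measurable lebesgue" for n
    by (rule measurable_completion) measurable
  have "(\<lambda>x. lim (\<lambda>n. ?q n x)) \<in> borel_measurable lebesgue"
    using q by (rule borel_measurable_lim_metric)
  moreover have "AE x in lebesgue. lim (\<lambda>n. ?q n x) = g x"
    using ae
  proof eventually_elim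
    case (elim x)
    then obtain D where D: "(f has_derivative D) (at x)" "g x = D (axis j 1)" by blast
    show ?case using limI[OF difference_quotient_tendsto[OF D(1), of j]] D(2) by simp
  qed
  ultimately show ?thesis by (rule borel_measurable_AE)
qed

text \<open>
  The difference quotients of \<open>f * \<phi>\<close> have integral zero, are uniformly bounded, and converge almost
  everywhere to the derivative of the product.
\<close>
lemma lipschitz_integration_by_parts:
  fixes f :: "real^'n::finite \<Rightarrow> real"
  assumes lip: "C-lipschitz_on UNIV f" and \<phi>: "test_function \<Omega> \<phi>"
    and ae: "AE x in lebesgue. \<exists>D. (f has_derivative D) (at x) \<and> g x = D (axis j 1)"
  shows "(LINT x|lebesgue. f x * partial_deriv j \<phi> x) = - (LINT x|lebesgue. g x * \<phi> x)"
proof -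
  let ?e = "axis j 1 :: real^'n"
  let ?h = "\<lambda>n. 1 / real (Suc n)"
  let ?p = "\<lambda>x. f x * \<phi> x"
  let ?q = "\<lambda>n x. (?p (x + ?h n *\<^sub>R ?e) - ?p x) * real (Suc n)"
  obtain r B where r: "r > 0" "B \<ge> 0" "\<And>x. norm x > r \<Longrightarrow> \<phi> x = 0" "\<And>x. norm x > r \<Longrightarrow> partial_deriv j \<phi> x = 0"
    "\<And>x. \<bar>\<phi> x\<bar> \<le> B" "\<And>x. \<bar>partial_deriv j \<phi> x\<bar> \<le> B"
    using test_function_bounds[OF \<phi>, of j] by metis
  have cf: "continuous_on UNIV f" using lip lipschitz_on_continuous_on by blast
  have [measurable]: "f \<in> borel_measurable borel" "\<phi> \<in> borel_measurable borel"
    "partial_deriv j \<phi> \<in> borel_measurable borel"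
    using cf test_function_derivative(2)[OF \<phi>] test_function_derivative(3)[OF \<phi>, of j] by (auto intro: borel_measurable_continuous_onI)
  have g: "g \<in> borel_measurable lebesgue" using cf ae by (rule partial_measurable)
  have C: "C \<ge> 0" using lip lipschitz_on_nonneg by blast
  have gC: "AE x in lebesgue. \<bar>g x\<bar> \<le> C"
    using ae by eventually_elim (use lipschitz_partial_bound[OF lip] in auto)
  \<comment> \<open>The difference quotient of the product lives in the ball of radius
    \<open>r + 1\<close>, and it evaluates \<open>f\<close> up to distance 1 from there.\<close>
  have "bounded (f ` cball 0 (r + 2))"
    by (intro compact_imp_bounded compact_continuous_image continuous_on_subset[OF cf]) auto
  then obtain F where F: "F > 0" "\<And>x. norm x \<le> r + 2 \<Longrightarrow> \<bar>f x\<bar> \<le> F"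
    unfolding bounded_pos by auto
  have p1: "\<bar>?p x\<bar> \<le> F * B" for x
    using F r by (cases "norm x \<le> r") (auto simp: abs_mult intro!: mult_mono)
  have p2: "\<bar>f x * partial_deriv j \<phi> x\<bar> \<le> F * B" for x
    using F r by (cases "norm x \<le> r") (auto simp: abs_mult intro!: mult_mono)
  have mp: "?p \<in> borel_measurable lebesgue" "(\<lambda>x. f x * partial_deriv j \<phi> x) \<in> borel_measurable lebesgue"
    "\<phi> \<in> borel_measurable lebesgue" "\<And>n. (\<lambda>x. ?p (x + ?h n *\<^sub>R ?e)) \<in> borel_measurable lebesgue"
    by (rule measurable_completion, measurable)+
  have mgp: "(\<lambda>x. g x * \<phi> x) \<in> borel_measurable lebesgue" using g mp by simp
  have ne: "norm (?h n *\<^sub>R ?e) \<le> 1" for n by simp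
  have sh: "norm x \<le> r + 1" if "norm (x + ?h n *\<^sub>R ?e) \<le> r" for x n
    using norm_triangle_ineq4[of "x + ?h n *\<^sub>R ?e" "?h n *\<^sub>R ?e"] ne[of n] that
    unfolding add_diff_cancel_right' by linarith
  have sh': "norm (x + ?h n *\<^sub>R ?e) > r" if "norm x > r + 1" for x n
    using sh[of x n] that by (meson not_le)
  have sh2: "norm (x + ?h n *\<^sub>R ?e) \<le> r + 2" if "norm x \<le> r + 1" for x n
    using norm_triangle_ineq[of "x" "?h n *\<^sub>R ?e"] ne[of n] that by linarith
  have ip: "integrable lebesgue ?p" "integrable lebesgue (\<lambda>x. f x * partial_deriv j \<phi> x)"
    using r by (auto intro!: integrable_bounded_support[where r=r and B="F*B"] mp p1 p2 always_eventually)
  have ip': "integrable lebesgue (\<lambda>x. ?p (x + ?h n *\<^sub>R ?e))" for n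
    by (rule integrable_bounded_support[where r="r+1" and B="F*B"])
      (use r(3)[OF sh'] mp p1 in auto)
  have "AE x in lebesgue. \<bar>g x * \<phi> x\<bar> \<le> C * B"
    using gC by eventually_elim (use r C in \<open>auto simp: abs_mult intro!: mult_mono\<close>)
  then have igp: "integrable lebesgue (\<lambda>x. g x * \<phi> x)"
    by (intro integrable_bounded_support[where r=r] mgp) (use r in auto)
  \<comment> \<open>Translation invariance is applied for \<open>lborel\<close> and carried to the
    completion by Borel measurability.\<close>
  have q0: "(LINT x|lebesgue. ?q n x) = 0" for n
  proof -
    have "(LINT x|lebesgue. ?p (x + ?h n *\<^sub>R ?e)) = (LINT x|lborel. ?p (x + ?h n *\<^sub>R ?e))"
      by (rule integral_completion) measurable
    also have "\<dots> = (LINT x|lborel. ?p x)"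
      by (rule lborel_integral_translation[where f = ?p]) measurable
    also have "\<dots> = (LINT x|lebesgue. ?p x)"
      by (rule integral_completion[symmetric]) measurable
    finally show ?thesis using ip ip' by simp
  qed
  have bound: "\<bar>?q n x\<bar> \<le> (F * B + C * B) * indicator (cball 0 (r + 1)) x" for n x
  proof (cases "norm x \<le> r + 1")
    case True
    \<comment> \<open>Discrete product rule: the first term is controlled by the derivative of
      \<open>\<phi>\<close>, the second by the Lipschitz constant of \<open>f\<close>.\<close>
    have "?q n x = f (x + ?h n *\<^sub>R ?e) * ((\<phi> (x + ?h n *\<^sub>R ?e) - \<phi> x) * real (Suc n))
        + ((f (x + ?h n *\<^sub>R ?e) - f x) * real (Suc n)) * \<phi> x"
      by (simp add: algebra_simps)
    also have "\<bar>\<dots>\<bar> \<le> \<bar>f (x + ?h n *\<^sub>R ?e)\<bar> * \<bar>(\<phi> (x + ?h n *\<^sub>R ?e) - \<phi> x) * real (Suc n)\<bar>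
        + \<bar>(f (x + ?h n *\<^sub>R ?e) - f x) * real (Suc n)\<bar> * \<bar>\<phi> x\<bar>"
      by (rule order_trans[OF abs_triangle_ineq]) (simp only: abs_mult order.refl)
    also have "\<dots> \<le> F * B + C * B"
    proof (intro add_mono mult_mono)
      show "\<bar>f (x + ?h n *\<^sub>R ?e)\<bar> \<le> F" using F(2) sh2 True by blast
      show "\<bar>(\<phi> (x + ?h n *\<^sub>R ?e) - \<phi> x) * real (Suc n)\<bar> \<le> B"
        using test_function_lipschitz_axis[OF \<phi> r(6), of "?h n" x]
        by (intro abs_mult_Suc_le) simp
      show "\<bar>(f (x + ?h n *\<^sub>R ?e) - f x) * real (Suc n)\<bar> \<le> C"
        using lipschitz_onD[OF lip, of "x + ?h n *\<^sub>R ?e" x]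
        by (intro abs_mult_Suc_le) (simp add: dist_norm)
    qed (use F C r in auto)
    finally show ?thesis using True by simp
  next
    case False
    then have "\<phi> x = 0" "\<phi> (x + ?h n *\<^sub>R ?e) = 0" using r(3)[of x] r(3)[OF sh', of x n] by auto
    then show ?thesis using False by simp
  qed
  have "(\<lambda>n. LINT x|lebesgue. ?q n x) \<longlonglongrightarrow> (LINT x|lebesgue. f x * partial_deriv j \<phi> x + g x * \<phi> x)"
  proof (rule integral_dominated_convergence)
    show "integrable lebesgue (\<lambda>x::real^'n. (F * B + C * B) * indicator (cball 0 (r + 1)) x :: real)"
      by (rule integrable_const_cball)
    show "AE x in lebesgue. norm (?q n x) \<le> (F * B + C * B) * indicator (cball 0 (r + 1)) x" for n
      using bound by (intro always_eventually) auto
    show "AE x in lebesgue. (\<lambda>n. ?q n x) \<longlonglongrightarrow> f x * partial_deriv j \<phi> x + g x * \<phi> x"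
      using ae
    proof eventually_elim
      case (elim x)
      then obtain D where D: "(f has_derivative D) (at x)" "g x = D ?e" by blast
      have "(?p has_derivative (\<lambda>h. f x * frechet_derivative \<phi> (at x) h + D h * \<phi> x)) (at x)"
        by (rule has_derivative_mult[OF D(1) test_function_derivative(1)[OF \<phi>]])
      from difference_quotient_tendsto[OF this, of j] show ?case
        using D(2) by (simp add: partial_deriv_def)
    qed
  qed (use mp mgp in auto)
  then have "(LINT x|lebesgue. f x * partial_deriv j \<phi> x + g x * \<phi> x) = 0"
    using q0 LIMSEQ_unique[OF _ tendsto_const] by simp
  then show ?thesis using ip igp by simp
qed

text \<open>Integration by parts survives dominated limits. A constant dominates the functions,
  since it is tested against something bounded with compact support; the gradients need an
  integrable majorant \<open>H\<close> because they may be unbounded in the limit.\<close>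

lemma weak_partial_limit:
  fixes f :: "real^'n::finite \<Rightarrow> real"
  assumes "locally_integrable \<Omega> f" "locally_integrable \<Omega> g"
    and meas: "\<And>n. fn n \<in> borel_measurable lebesgue" "\<And>n. gn n \<in> borel_measurable lebesgue"
      "f \<in> borel_measurable lebesgue" "g \<in> borel_measurable lebesgue"
    and parts: "\<And>n \<phi>. test_function \<Omega> \<phi> \<Longrightarrow>
      (LINT x|lebesgue. fn n x * partial_deriv j \<phi> x) = - (LINT x|lebesgue. gn n x * \<phi> x)"
    and lim: "AE x in lebesgue. (\<lambda>n. fn n x) \<longlonglongrightarrow> f x" "AE x in lebesgue. (\<lambda>n. gn n x) \<longlonglongrightarrow> g x"
    and bound: "\<And>n. AE x in lebesgue. \<bar>fn n x\<bar> \<le> K"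
      "\<And>n. AE x in lebesgue. \<bar>gn n x\<bar> \<le> H x" "integrable lebesgue H"
  shows "has_weak_partial \<Omega> j f g"
  unfolding has_weak_partial_def
proof (intro conjI allI impI)
  fix \<phi> assume \<phi>: "test_function \<Omega> \<phi>"
  obtain r B where r: "r > 0" "B \<ge> 0" "\<And>x. norm x > r \<Longrightarrow> \<phi> x = 0" "\<And>x. norm x > r \<Longrightarrow> partial_deriv j \<phi> x = 0"
    "\<And>x. \<bar>\<phi> x\<bar> \<le> B" "\<And>x. \<bar>partial_deriv j \<phi> x\<bar> \<le> B"
    using test_function_bounds[OF \<phi>, of j] by metis
  have [measurable]: "\<phi> \<in> borel_measurable borel" "partial_deriv j \<phi> \<in> borel_measurable borel"
    using test_function_derivative(2)[OF \<phi>] test_function_derivative(3)[OF \<phi>, of j] by (auto intro: borel_measurable_continuous_onI)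
  have m: "\<phi> \<in> borel_measurable lebesgue" "partial_deriv j \<phi> \<in> borel_measurable lebesgue"
    by (rule measurable_completion, measurable)+
  have lf: "(\<lambda>n. LINT x|lebesgue. fn n x * partial_deriv j \<phi> x) \<longlonglongrightarrow> (LINT x|lebesgue. f x * partial_deriv j \<phi> x)"
  proof (rule integral_dominated_convergence)
    show "integrable lebesgue (\<lambda>x::real^'n. (K * B) * indicator (cball 0 r) x :: real)"
      by (rule integrable_const_cball)
    show "AE x in lebesgue. (\<lambda>n. fn n x * partial_deriv j \<phi> x) \<longlonglongrightarrow> f x * partial_deriv j \<phi> x"
      using lim(1) by eventually_elim (intro tendsto_intros)
    show "AE x in lebesgue. norm (fn n x * partial_deriv j \<phi> x) \<le> (K * B) * indicator (cball 0 r) x" for n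
      using bound(1)[of n]
    proof eventually_elim
      case (elim x)
      then have "\<bar>fn n x\<bar> * \<bar>partial_deriv j \<phi> x\<bar> \<le> K * B" using r by (intro mult_mono) auto
      then show ?case using r(4)[of x] by (auto simp: indicator_def abs_mult)
    qed
  qed (use meas m in auto)
  have lg: "(\<lambda>n. LINT x|lebesgue. gn n x * \<phi> x) \<longlonglongrightarrow> (LINT x|lebesgue. g x * \<phi> x)"
  proof (rule integral_dominated_convergence)
    show "integrable lebesgue (\<lambda>x. H x * B)" using bound(3) by simp
    show "AE x in lebesgue. (\<lambda>n. gn n x * \<phi> x) \<longlonglongrightarrow> g x * \<phi> x"
      using lim(2) by eventually_elim (intro tendsto_intros)
    show "AE x in lebesgue. norm (gn n x * \<phi> x) \<le> H x * B" for n
      using bound(2)[of n] by eventually_elim (use r in \<open>auto simp: abs_mult intro!: mult_mono\<close>)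
  qed (use meas m in auto)
  have "(LINT x|lebesgue. f x * partial_deriv j \<phi> x) = - (LINT x|lebesgue. g x * \<phi> x)"
    by (rule LIMSEQ_unique[OF lf]) (simp add: parts[OF \<phi>] tendsto_minus[OF lg])
  then show "(LINT x:\<Omega>|lebesgue. f x * partial_deriv j \<phi> x) = - (LINT x:\<Omega>|lebesgue. g x * \<phi> x)"
    using test_function_set_integral[OF \<phi>] by metis
qed (use assms in auto)

section \<open>Closure properties of Lipschitz maps\<close>

definition lipschitzian :: "('a::metric_space \<Rightarrow> 'b::metric_space) \<Rightarrow> bool" where
  "lipschitzian f \<longleftrightarrow> (\<exists>C. C-lipschitz_on UNIV f)"

lemma lipschitzian_const: "lipschitzian (\<lambda>x. c)"
  and lipschitzian_nth: "lipschitzian (\<lambda>x::real^'n::finite. x $ i)"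
  unfolding lipschitzian_def
  by (intro exI lipschitz_on_constant) (auto intro!: exI[of _ 1] lipschitz_onI dist_vec_nth_le)

lemma lipschitzian_add: "lipschitzian f \<Longrightarrow> lipschitzian g \<Longrightarrow> lipschitzian (\<lambda>x. f x + g x)"
  and lipschitzian_diff: "lipschitzian f \<Longrightarrow> lipschitzian g \<Longrightarrow> lipschitzian (\<lambda>x. f x - g x)"
  and lipschitzian_minus: "lipschitzian f \<Longrightarrow> lipschitzian (\<lambda>x. - f x)"
  and lipschitzian_scaleR: "lipschitzian f \<Longrightarrow> lipschitzian (\<lambda>x. c *\<^sub>R f x)"
  for f g :: "'a::metric_space \<Rightarrow> 'b::real_normed_vector"
  unfolding lipschitzian_def
  by (blast intro: lipschitz_on_add lipschitz_on_diff lipschitz_on_minus lipschitz_on_cmult)+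

lemma lipschitzian_scaleR_left: "lipschitzian f \<Longrightarrow> lipschitzian (\<lambda>x. f x *\<^sub>R c)"
  for f :: "'a::metric_space \<Rightarrow> real" and c :: "'b::real_normed_vector"
  unfolding lipschitzian_def
proof safe
  fix C assume C: "C-lipschitz_on UNIV f"
  have "(C * norm c)-lipschitz_on UNIV (\<lambda>x. f x *\<^sub>R c)"
  proof (rule lipschitz_onI)
    fix x y
    have "dist (f x *\<^sub>R c) (f y *\<^sub>R c) = dist (f x) (f y) * norm c"
      by (simp add: dist_norm flip: scaleR_diff_left)
    also have "\<dots> \<le> (C * dist x y) * norm c"
      using lipschitz_onD[OF C] by (intro mult_right_mono) auto
    finally show "dist (f x *\<^sub>R c) (f y *\<^sub>R c) \<le> C * norm c * dist x y" by (simp add: mult_ac)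
  qed (use lipschitz_on_nonneg[OF C] in simp)
  then show "\<exists>C. C-lipschitz_on UNIV (\<lambda>x. f x *\<^sub>R c)" by blast
qed

lemma lipschitzian_mult: "lipschitzian f \<Longrightarrow> lipschitzian (\<lambda>x. c * f x)"
  for f :: "'a::metric_space \<Rightarrow> real"
  using lipschitzian_scaleR[of f c] by simp

lemma lipschitzian_divide: "lipschitzian f \<Longrightarrow> lipschitzian (\<lambda>x. f x / c)"
  for f :: "'a::metric_space \<Rightarrow> real"
  using lipschitzian_mult[of f "1 / c"] by simp

lemma lipschitzian_min: "lipschitzian f \<Longrightarrow> lipschitzian g \<Longrightarrow> lipschitzian (\<lambda>x. min (f x) (g x))"
  and lipschitzian_max: "lipschitzian f \<Longrightarrow> lipschitzian g \<Longrightarrow> lipschitzian (\<lambda>x. max (f x) (g x))"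
  for f g :: "'a::metric_space \<Rightarrow> real"
  unfolding lipschitzian_def
proof safe
  fix C D assume C: "C-lipschitz_on UNIV f" "D-lipschitz_on UNIV g"
  have *: "\<bar>f x - f y\<bar> \<le> (C + D) * dist x y" "\<bar>g x - g y\<bar> \<le> (C + D) * dist x y" for x y
    using lipschitz_onD[OF C(1), of x y] lipschitz_onD[OF C(2), of x y]
      mult_nonneg_nonneg[OF lipschitz_on_nonneg[OF C(1)] zero_le_dist[of x y]]
      mult_nonneg_nonneg[OF lipschitz_on_nonneg[OF C(2)] zero_le_dist[of x y]]
    by (auto simp: dist_real_def algebra_simps)
  have "(C + D)-lipschitz_on UNIV (\<lambda>x. min (f x) (g x))" "(C + D)-lipschitz_on UNIV (\<lambda>x. max (f x) (g x))"
    using lipschitz_on_nonneg[OF C(1)] lipschitz_on_nonneg[OF C(2)] *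
    by (auto intro!: lipschitz_onI simp: dist_real_def) (smt (verit) *)+
  then show "\<exists>E. E-lipschitz_on UNIV (\<lambda>x. min (f x) (g x))" "\<exists>E. E-lipschitz_on UNIV (\<lambda>x. max (f x) (g x))"
    by blast+
qed

text \<open>
  Choosing the value \<open>0\<close> where \<open>f\<close> is not differentiable makes the symmetry of the phases below hold at
  every point, and not just almost everywhere.
\<close>
definition grad :: "(real^'n::finite \<Rightarrow> real^'m::finite) \<Rightarrow> real^'n \<Rightarrow> real^'n^'m" where
  "grad f x = (if f differentiable (at x) then matrix (frechet_derivative f (at x)) else 0)"

lemma grad_eq:
  assumes "(f has_derivative (*v) A) (at x)"
  shows "grad f x = A"
proof -
  have "frechet_derivative f (at x) = (*v) A"
    using frechet_derivative_at[OF assms] by simp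
  then show ?thesis
    using assms unfolding grad_def differentiable_def by auto
qed

lemma grad_has_derivative:
  assumes "f differentiable (at x)"
  shows "(f has_derivative (*v) (grad f x)) (at x)"
proof -
  have *: "(f has_derivative frechet_derivative f (at x)) (at x)"
    using assms by (simp add: frechet_derivative_works)
  have "frechet_derivative f (at x) = (*v) (grad f x)"
    using assms matrix_vector_mul(2)[OF has_derivative_linear[OF *]]
    unfolding grad_def by simp
  then show ?thesis using * by simp
qed

lemma has_derivative_component:
  assumes "(f has_derivative (*v) A) (at x)"
  shows "((\<lambda>y. f y $ i) has_derivative (\<lambda>h. (A *v h) $ i)) (at x)"
  using bounded_linear.has_derivative[OF bounded_linear_vec_nth assms] .

lemma matrix_axis: "((A::real^'n::finite^'m::finite) *v axis j 1) $ i = A $ i $ j"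
  by (simp add: matrix_vector_mult_basis column_def)

lemma lipschitz_nth: "C-lipschitz_on U f \<Longrightarrow> C-lipschitz_on U (\<lambda>x. f x $ i)"
  for f :: "'a::metric_space \<Rightarrow> real^'n::finite"
  by (rule lipschitz_onI) (auto dest: lipschitz_onD lipschitz_on_nonneg intro: order_trans[OF dist_vec_nth_le])

lemma lipschitz_matrix_bound:
  fixes f :: "real^'n::finite \<Rightarrow> real^'m::finite"
  assumes "C-lipschitz_on UNIV f" "(f has_derivative (*v) A) (at x)"
  shows "\<bar>A $ i $ j\<bar> \<le> C"
  using lipschitz_partial_bound[OF lipschitz_nth[OF assms(1)] has_derivative_component[OF assms(2)], of j i]
  by (simp add: matrix_axis)

lemma measurable_lebesgue_continuous:
  fixes f :: "'a::euclidean_space \<Rightarrow> 'b::{second_countable_topology, metric_space}"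
  assumes "continuous_on UNIV f"
  shows "f \<in> borel_measurable lebesgue"
  by (rule measurable_completion) (simp add: borel_measurable_continuous_onI[OF assms])

lemma integrable_bounded_set:
  fixes f :: "real^'n::finite \<Rightarrow> real"
  assumes "f \<in> borel_measurable lebesgue" "S \<in> sets lebesgue" "bounded S" "\<And>x. x \<in> S \<Longrightarrow> \<bar>f x\<bar> \<le> B"
  shows "integrable lebesgue (\<lambda>x. indicator S x *\<^sub>R f x)"
proof -
  obtain r where r: "\<And>x. x \<in> S \<Longrightarrow> norm x \<le> r" using assms(3) unfolding bounded_iff by blast
  show ?thesis
  proof (rule integrable_bounded_support[where r=r and B="\<bar>B\<bar>"])
    show "AE x in lebesgue. \<bar>indicator S x *\<^sub>R f x\<bar> \<le> \<bar>B\<bar>"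
      using assms(4) by (intro always_eventually) (force simp: indicator_def)
    show "indicator S x *\<^sub>R f x = 0" if "norm x > r" for x
      using r[of x] that by (auto simp: indicator_def)
  qed (use assms in auto)
qed

lemma continuous_locally_integrable:
  assumes "continuous_on UNIV f"
  shows "locally_integrable \<Omega> f"
  unfolding locally_integrable_def set_integrable_def
proof (intro allI impI)
  fix K assume K: "compact K \<and> K \<subseteq> \<Omega>"
  then have "bounded (f ` K)"
    by (intro compact_imp_bounded compact_continuous_image continuous_on_subset[OF assms]) auto
  then obtain B where "\<And>x. x \<in> K \<Longrightarrow> \<bar>f x\<bar> \<le> B" unfolding bounded_iff by auto
  then show "integrable lebesgue (\<lambda>x. indicator K x *\<^sub>R f x)"
    using K compact_imp_bounded[of K] compact_imp_closed[of K]
    by (intro integrable_bounded_set measurable_lebesgue_continuous assms) auto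
qed

lemma integrable_locally_integrable:
  assumes "integrable lebesgue f"
  shows "locally_integrable \<Omega> f"
  unfolding locally_integrable_def set_integrable_def
  by (intro allI impI integrable_mult_indicator assms) (auto intro: fmeasurableD lmeasurable_compact)

lemma measure_le_of_orthogonal_image:
  fixes f :: "real^2 \<Rightarrow> real^2"
  assumes "orthogonal_transformation f" "S \<in> lmeasurable" "T \<in> lmeasurable" "f ` S \<subseteq> T"
  shows "measure lebesgue S \<le> measure lebesgue T"
  using measure_mono_fmeasurable[OF assms(4) _ assms(3)] measure_orthogonal_image[OF assms(1,2)]
    measurable_orthogonal_image[OF assms(1,2)] by (simp add: fmeasurableD)

section \<open>The piecewise affine map on one triangle\<close>

text \<open>
  In the coordinates \<open>a, b, c\<close> (with sum \<open>0\<close>) the triangle \<open>T\<close> is \<open>a, b, c \<le> 1\<close>, and \<open>T'\<close> has the vertex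
  \<open>P = (2 * \<lambda>, -\<lambda>, -\<lambda>)\<close>. The value \<open>hat a b c / 3\<close> is the nodal basis function at \<open>P\<close>: the cone with
  apex \<open>P\<close> over the trapezoid formed by the triangles around \<open>P\<close>. Each argument of the minimum
  is the affine function that vanishes on one side of the trapezoid and equals \<open>3\<close> at \<open>P\<close>.
\<close>
definition hat :: "real \<Rightarrow> real \<Rightarrow> real \<Rightarrow> real" where
  "hat a b c = max 0 (min (min ((3 + 2 * sqrt 3) * (1 - a)) ((2 + sqrt 3) * a + 1))
     (min (a - (1 + sqrt 3) * b + sqrt 3) (a - (1 + sqrt 3) * c + sqrt 3)))"

lemma sqrt3: "sqrt 3 * sqrt 3 = (3::real)" "1 < sqrt (3::real)" "sqrt (3::real) < 2"
  "0 < 1 + sqrt (3::real)"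
  by (auto intro: real_less_rsqrt real_less_lsqrt add_pos_nonneg)

lemma hat_eq_0:
  assumes "a \<ge> 1 \<or> a \<le> sqrt 3 - 2 \<or> a - (1 + sqrt 3) * b + sqrt 3 \<le> 0 \<or> a - (1 + sqrt 3) * c + sqrt 3 \<le> 0"
  shows "hat a b c = 0"
proof -
  have 1: "(3 + 2 * sqrt 3) * (1 - a) \<le> 0" if "a \<ge> 1"
    using that sqrt3 by (simp add: mult_nonneg_nonpos)
  have 2: "(2 + sqrt 3) * a + 1 \<le> 0" if "a \<le> sqrt 3 - 2"
  proof -
    have "(2 + sqrt 3) * a \<le> (2 + sqrt 3) * (sqrt 3 - 2)"
      using that sqrt3 by (intro mult_left_mono) auto
    also have "\<dots> = -1" using sqrt3(1) by (simp add: algebra_simps)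
    finally show ?thesis by simp
  qed
  show ?thesis unfolding hat_def using assms 1 2 by (smt (verit))
qed

text \<open>Beyond the side \<open>b = 1\<close>, either also \<open>a \<ge> 1\<close>, or the
  slanted argument of the minimum that contains \<open>b\<close> is nonpositive; likewise for
  \<open>c\<close>.\<close>

lemma hat_outside:
  assumes "a + b + c = 0" "1 \<le> a \<or> 1 \<le> b \<or> 1 \<le> c"
  shows "hat a b c = 0"
proof -
  have *: "x - (1 + sqrt 3) * y + sqrt 3 \<le> 0" if "1 \<le> y" "x \<le> 1" for x y :: real
  proof -
    have "(1 + sqrt 3) * 1 \<le> (1 + sqrt 3) * y" using that sqrt3 by (intro mult_left_mono) auto
    then show ?thesis using that by simp
  qed
  show ?thesis using assms(2) *[of b a] *[of c a] hat_eq_0[of a b c] by linarith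
qed

lemma hat_inside:
  assumes "a + b + c = 0" "sqrt 3 - 2 \<le> a" "sqrt 3 - 2 \<le> b" "sqrt 3 - 2 \<le> c"
  shows "hat a b c = (2 + sqrt 3) * a + 1"
proof -
  have a: "a = - b - c" using assms by simp
  \<comment> \<open>In this order: the gap between the first argument of the minimum and the claimed
    one, the claimed value itself, and the gaps to the two slanted arguments. The bound
    \<open>a \<le> 2 * (2 - sqrt 3)\<close> comes from those on \<open>b\<close> and
    \<open>c\<close>.\<close>
  have "(5 + 3 * sqrt 3) * (2 * (2 - sqrt 3) - a) \<ge> 0" "(2 + sqrt 3) * (a - (sqrt 3 - 2)) \<ge> 0"
    "(1 + sqrt 3) * (b - (sqrt 3 - 2)) \<ge> 0" "(1 + sqrt 3) * (c - (sqrt 3 - 2)) \<ge> 0"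
    using assms sqrt3 by (auto intro!: mult_nonneg_nonneg)
  then show ?thesis unfolding hat_def a using sqrt3(1)
    by (auto simp: algebra_simps max_def min_def)
qed

lemma hat_edge:
  assumes "a + b + c = 0" "a \<le> 1" "b - (1 + sqrt 3) * a + sqrt 3 \<le> 0" "c - (1 + sqrt 3) * a + sqrt 3 \<le> 0"
  shows "hat a b c = (3 + 2 * sqrt 3) * (1 - a)"
proof -
  have a: "c = - a - b" using assms by simp
  have "(b - (1 + sqrt 3) * a + sqrt 3) + (c - (1 + sqrt 3) * a + sqrt 3) \<le> 0"
    using assms by linarith
  \<comment> \<open>The claimed value, followed by negative multiples of its gaps to the other three
    arguments of the minimum.\<close>
  then have "(3 + 2 * sqrt 3) * (1 - a) \<ge> 0"
    "(1 + sqrt 3) * (b - (1 + sqrt 3) * a + sqrt 3) \<le> 0" "(1 + sqrt 3) * (c - (1 + sqrt 3) * a + sqrt 3) \<le> 0"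
    "(3 + sqrt 3) * ((b - (1 + sqrt 3) * a + sqrt 3) + (c - (1 + sqrt 3) * a + sqrt 3)) \<le> 0"
    using assms sqrt3 by (intro mult_nonneg_nonneg mult_nonneg_nonpos; simp)+
  then show ?thesis unfolding hat_def a using sqrt3(1)
    by (auto simp: algebra_simps max_def min_def)
qed

text \<open>Over a corner triangle the face through the outer corner and the other inner vertex is
  lowest. Both argument orders are stated because the cyclic arguments in \<open>star\<close>
  present the two adjacent hats in opposite orientations.\<close>

lemma hat_corner:
  assumes "a + b + c = 0" "c \<le> sqrt 3 - 2" "a - (1 + sqrt 3) * b + sqrt 3 \<ge> 0" "b - (1 + sqrt 3) * a + sqrt 3 \<ge> 0"
  shows "hat a b c = a - (1 + sqrt 3) * b + sqrt 3" "hat a c b = a - (1 + sqrt 3) * b + sqrt 3"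
proof -
  \<comment> \<open>This orders the two slanted arguments. Otherwise \<open>a\<close> would exceed
    its value \<open>2 * (2 - sqrt 3)\<close> at the inner vertex, against the last
    hypothesis.\<close>
  have "c \<le> b"
  proof (rule ccontr)
    assume "\<not> c \<le> b"
    then have "b < sqrt 3 - 2" "2 * (2 - sqrt 3) < a" using assms by auto
    moreover from this have "(1 + sqrt 3) * (2 * (2 - sqrt 3)) < (1 + sqrt 3) * a"
      using sqrt3 by (intro mult_strict_left_mono) auto
    ultimately show False using assms sqrt3(1) by (simp add: algebra_simps)
  qed
  then have "(1 + sqrt 3) * (b - (1 + sqrt 3) * a + sqrt 3) \<ge> 0" "(1 + sqrt 3) * (b - c) \<ge> 0"
    "(1 + sqrt 3) * (sqrt 3 - 2 - c) \<ge> 0"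
    using assms sqrt3 by (auto intro!: mult_nonneg_nonneg)
  moreover have a: "c = - a - b" using assms by simp
  ultimately show "hat a b c = a - (1 + sqrt 3) * b + sqrt 3" "hat a c b = a - (1 + sqrt 3) * b + sqrt 3"
    using assms(3) unfolding hat_def a using sqrt3(1)
    by (auto simp: algebra_simps max_def min_def)
qed

text \<open>Beyond one side of the inner triangle lie two edge regions and one corner region. By
  \<open>*\<close>, one of the two inequalities of an edge region implies the other; the comparison
  value \<open>2 * (2 - sqrt 3)\<close> is the coordinate of the inner vertex where its two bounding
  lines meet.\<close>

lemma annulus_cases:
  assumes "a + b + c = 0" "c \<le> sqrt 3 - 2"
  shows "(b - (1 + sqrt 3) * a + sqrt 3 \<le> 0 \<and> c - (1 + sqrt 3) * a + sqrt 3 \<le> 0) \<or>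
    (a - (1 + sqrt 3) * b + sqrt 3 \<le> 0 \<and> c - (1 + sqrt 3) * b + sqrt 3 \<le> 0) \<or>
    (b - (1 + sqrt 3) * a + sqrt 3 \<ge> 0 \<and> a - (1 + sqrt 3) * b + sqrt 3 \<ge> 0)"
proof -
  have *: "z - (1 + sqrt 3) * x + sqrt 3 \<le> 0"
    if "x + y + z = 0" "z \<le> sqrt 3 - 2" "y - (1 + sqrt 3) * x + sqrt 3 \<le> 0" for x y z :: real
  proof (cases "2 * (2 - sqrt 3) \<le> x")
    case True
    then have "(1 + sqrt 3) * (2 * (2 - sqrt 3)) \<le> (1 + sqrt 3) * x"
      using sqrt3 by (intro mult_left_mono) auto
    then show ?thesis using that sqrt3(1) by (simp add: algebra_simps)
  next
    case False
    then have "(1 + sqrt 3) * x \<le> (1 + sqrt 3) * (2 * (2 - sqrt 3))"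
      using sqrt3 by (intro mult_left_mono) auto
    then show ?thesis using that sqrt3(1) False by (simp add: algebra_simps)
  qed
  show ?thesis using *[of a b c] *[of b a c] assms by linarith
qed

text \<open>Normal form for arithmetic with \<open>sqrt 3\<close>; the last rule also catches
  \<open>sqrt 3 * (sqrt 3 * y)\<close>.\<close>

lemmas r_simps = algebra_simps add_divide_distrib diff_divide_distrib sqrt3(1)
  sqrt3(1)[THEN arg_cong[where f="\<lambda>z. z * y" for y], unfolded mult.assoc]

text \<open>The inner products with the outer normals \<open>n\<^sub>1, n\<^sub>2, n\<^sub>3\<close>, all of length \<open>sqrt 2\<close>.\<close>
definition sa :: "real^2 \<Rightarrow> real" where "sa x = x$1 - x$2"
definition sb :: "real^2 \<Rightarrow> real" where "sb x = ((sqrt 3 - 1) * x$1 + (sqrt 3 + 1) * x$2) / 2"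
definition sc :: "real^2 \<Rightarrow> real" where "sc x = - ((sqrt 3 + 1) * x$1 + (sqrt 3 - 1) * x$2) / 2"

lemmas s_defs = sa_def sb_def sc_def

text \<open>The vectors are \<open>n\<^sub>1, n\<^sub>2, n\<^sub>3\<close> turned by 90 degrees.\<close>
definition star :: "real \<Rightarrow> real^2 \<Rightarrow> real^2" where
  "star \<epsilon> x = (\<epsilon> * (3 - 2 * sqrt 3) / 3) *\<^sub>R
     (hat (sa x) (sb x) (sc x) *\<^sub>R vector [1, 1] +
      hat (sb x) (sc x) (sa x) *\<^sub>R vector [- (sqrt 3 + 1) / 2, (sqrt 3 - 1) / 2] +
      hat (sc x) (sa x) (sb x) *\<^sub>R vector [(sqrt 3 - 1) / 2, - (sqrt 3 + 1) / 2])"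

definition triangle :: "(real^2) set" where
  "triangle = {x. sa x \<le> 1 \<and> sb x \<le> 1 \<and> sc x \<le> 1}"

text \<open>\<open>x\<close> lies on none of the lines that contain the edges of the triangulation.\<close>
definition generic :: "real^2 \<Rightarrow> bool" where
  "generic x \<longleftrightarrow> sa x \<noteq> 1 \<and> sb x \<noteq> 1 \<and> sc x \<noteq> 1 \<and>
     sa x \<noteq> sqrt 3 - 2 \<and> sb x \<noteq> sqrt 3 - 2 \<and> sc x \<noteq> sqrt 3 - 2 \<and>
     sa x - (1 + sqrt 3) * sb x + sqrt 3 \<noteq> 0 \<and> sb x - (1 + sqrt 3) * sa x + sqrt 3 \<noteq> 0 \<and>
     sb x - (1 + sqrt 3) * sc x + sqrt 3 \<noteq> 0 \<and> sc x - (1 + sqrt 3) * sb x + sqrt 3 \<noteq> 0 \<and>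
     sc x - (1 + sqrt 3) * sa x + sqrt 3 \<noteq> 0 \<and> sa x - (1 + sqrt 3) * sc x + sqrt 3 \<noteq> 0"

definition wells :: "real \<Rightarrow> (real^2^2) set" where
  "wells \<epsilon> = {\<epsilon> *\<^sub>R vector [vector [1, 0], vector [0, -1]],
     \<epsilon> *\<^sub>R vector [vector [-1/2, sqrt 3 / 2], vector [sqrt 3 / 2, 1/2]],
     \<epsilon> *\<^sub>R vector [vector [-1/2, - (sqrt 3 / 2)], vector [- (sqrt 3 / 2), 1/2]]}"

section \<open>Values of \<open>star\<close> on the pieces of the triangulation\<close>

lemma s_sum: "sa x + sb x + sc x = 0"
  unfolding s_defs by (simp add: field_simps)

lemma s_scaleR: "sa (c *\<^sub>R x) = c * sa x" "sb (c *\<^sub>R x) = c * sb x" "sc (c *\<^sub>R x) = c * sc x"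
  unfolding s_defs by (simp_all add: algebra_simps)

lemma s_continuous [continuous_intros]:
  "continuous_on S sa" "continuous_on S sb" "continuous_on S sc"
  unfolding s_defs by (auto intro!: continuous_intros)

lemma star_outside:
  assumes "1 \<le> sa x \<or> 1 \<le> sb x \<or> 1 \<le> sc x"
  shows "star \<epsilon> x = 0"
proof -
  have "hat (sa x) (sb x) (sc x) = 0" "hat (sb x) (sc x) (sa x) = 0" "hat (sc x) (sa x) (sb x) = 0"
    using assms s_sum[of x] by (auto intro!: hat_outside)
  then show ?thesis unfolding star_def by simp
qed

text \<open>The turned normals sum to zero, so the constants of the three hats cancel. The linear
  parts add up to a multiple of the quarter turn of \<open>x\<close>, because the sum of the
  projections \<open>n n^T\<close> over the three normals is 3 times the identity.\<close>

lemma star_inside: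
  assumes "sqrt 3 - 2 \<le> sa x" "sqrt 3 - 2 \<le> sb x" "sqrt 3 - 2 \<le> sc x"
  shows "star \<epsilon> x = (\<epsilon> * sqrt 3) *\<^sub>R vector [x$2, - x$1]"
proof -
  have h: "hat (sa x) (sb x) (sc x) = (2 + sqrt 3) * sa x + 1"
    "hat (sb x) (sc x) (sa x) = (2 + sqrt 3) * sb x + 1"
    "hat (sc x) (sa x) (sb x) = (2 + sqrt 3) * sc x + 1"
    using assms s_sum[of x] by (auto intro!: hat_inside)
  show ?thesis
    unfolding star_def h by (simp add: vec_eq_iff forall_2 s_defs r_simps)
qed

text \<open>Only one hat is active. The prefactor of \<open>star\<close> is normalised by
  \<open>(3 + 2 * sqrt 3) * (3 - 2 * sqrt 3) / 3 = -1\<close>, so the gradient is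
  \<open>\<epsilon>\<close> times the tensor product of the turned normal with the normal, whose
  symmetric part is a well.\<close>

lemma star_edge_a:
  assumes "sa x \<le> 1" "sb x - (1 + sqrt 3) * sa x + sqrt 3 \<le> 0" "sc x - (1 + sqrt 3) * sa x + sqrt 3 \<le> 0"
  shows "star \<epsilon> x = (\<epsilon> * (sa x - 1)) *\<^sub>R vector [1, 1]"
proof -
  have h: "hat (sa x) (sb x) (sc x) = (3 + 2 * sqrt 3) * (1 - sa x)"
    "hat (sb x) (sc x) (sa x) = 0" "hat (sc x) (sa x) (sb x) = 0"
    using assms s_sum[of x] by (auto intro: hat_edge hat_eq_0)
  show ?thesis
    unfolding star_def h by (simp add: vec_eq_iff forall_2 r_simps)
qed

lemma star_edge_b:
  assumes "sb x \<le> 1" "sc x - (1 + sqrt 3) * sb x + sqrt 3 \<le> 0" "sa x - (1 + sqrt 3) * sb x + sqrt 3 \<le> 0"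
  shows "star \<epsilon> x = (\<epsilon> * (sb x - 1)) *\<^sub>R vector [- (sqrt 3 + 1) / 2, (sqrt 3 - 1) / 2]"
proof -
  have h: "hat (sb x) (sc x) (sa x) = (3 + 2 * sqrt 3) * (1 - sb x)"
    "hat (sa x) (sb x) (sc x) = 0" "hat (sc x) (sa x) (sb x) = 0"
    using assms s_sum[of x] by (auto intro: hat_edge hat_eq_0)
  show ?thesis
    unfolding star_def h by (simp add: vec_eq_iff forall_2 r_simps)
qed

lemma star_edge_c:
  assumes "sc x \<le> 1" "sa x - (1 + sqrt 3) * sc x + sqrt 3 \<le> 0" "sb x - (1 + sqrt 3) * sc x + sqrt 3 \<le> 0"
  shows "star \<epsilon> x = (\<epsilon> * (sc x - 1)) *\<^sub>R vector [(sqrt 3 - 1) / 2, - (sqrt 3 + 1) / 2]"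
proof -
  have h: "hat (sc x) (sa x) (sb x) = (3 + 2 * sqrt 3) * (1 - sc x)"
    "hat (sb x) (sc x) (sa x) = 0" "hat (sa x) (sb x) (sc x) = 0"
    using assms s_sum[of x] by (auto intro: hat_edge hat_eq_0)
  show ?thesis
    unfolding star_def h by (simp add: vec_eq_iff forall_2 r_simps)
qed

text \<open>The hats at the two adjacent inner vertices are active, and the third one vanishes
  beyond the side \<open>c = sqrt 3 - 2\<close>. The linear part has a well as its symmetric
  part.\<close>

lemma star_corner_ab:
  assumes "sc x \<le> sqrt 3 - 2" "sa x - (1 + sqrt 3) * sb x + sqrt 3 \<ge> 0" "sb x - (1 + sqrt 3) * sa x + sqrt 3 \<ge> 0"
  shows "star \<epsilon> x = \<epsilon> *\<^sub>R vector [- x$1 / 2 + (3 * sqrt 3 / 2 - 1) * x$2 + (3 * sqrt 3 - 5) / 2,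
    (1 - sqrt 3 / 2) * x$1 + x$2 / 2 + (1 - sqrt 3) / 2]"
proof -
  have h: "hat (sa x) (sb x) (sc x) = sa x - (1 + sqrt 3) * sb x + sqrt 3"
    "hat (sb x) (sc x) (sa x) = sb x - (1 + sqrt 3) * sa x + sqrt 3" "hat (sc x) (sa x) (sb x) = 0"
    using assms s_sum[of x] hat_corner[of "sa x" "sb x" "sc x"] hat_corner[of "sb x" "sa x" "sc x"]
    by (auto intro: hat_eq_0)
  show ?thesis
    unfolding star_def h by (simp add: vec_eq_iff forall_2 s_defs r_simps)
qed

lemma star_corner_bc:
  assumes "sa x \<le> sqrt 3 - 2" "sb x - (1 + sqrt 3) * sc x + sqrt 3 \<ge> 0" "sc x - (1 + sqrt 3) * sb x + sqrt 3 \<ge> 0"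
  shows "star \<epsilon> x = \<epsilon> *\<^sub>R vector [x$1 + (sqrt 3 - 1) * x$2 + (2 - sqrt 3),
    (1 - sqrt 3) * x$1 - x$2 + (2 - sqrt 3)]"
proof -
  have h: "hat (sb x) (sc x) (sa x) = sb x - (1 + sqrt 3) * sc x + sqrt 3"
    "hat (sc x) (sa x) (sb x) = sc x - (1 + sqrt 3) * sb x + sqrt 3" "hat (sa x) (sb x) (sc x) = 0"
    using assms s_sum[of x] hat_corner[of "sb x" "sc x" "sa x"] hat_corner[of "sc x" "sb x" "sa x"]
    by (auto intro: hat_eq_0)
  show ?thesis
    unfolding star_def h by (simp add: vec_eq_iff forall_2 s_defs r_simps)
qed

lemma star_corner_ca:
  assumes "sb x \<le> sqrt 3 - 2" "sc x - (1 + sqrt 3) * sa x + sqrt 3 \<ge> 0" "sa x - (1 + sqrt 3) * sc x + sqrt 3 \<ge> 0"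
  shows "star \<epsilon> x = \<epsilon> *\<^sub>R vector [- x$1 / 2 + (sqrt 3 / 2 - 1) * x$2 + (1 - sqrt 3) / 2,
    (1 - 3 * sqrt 3 / 2) * x$1 + x$2 / 2 + (3 * sqrt 3 - 5) / 2]"
proof -
  have h: "hat (sc x) (sa x) (sb x) = sc x - (1 + sqrt 3) * sa x + sqrt 3"
    "hat (sa x) (sb x) (sc x) = sa x - (1 + sqrt 3) * sc x + sqrt 3" "hat (sb x) (sc x) (sa x) = 0"
    using assms s_sum[of x] hat_corner[of "sc x" "sa x" "sb x"] hat_corner[of "sa x" "sc x" "sb x"]
    by (auto intro: hat_eq_0)
  show ?thesis
    unfolding star_def h by (simp add: vec_eq_iff forall_2 s_defs r_simps)
qed

section \<open>The derivative of \<open>star\<close> off the edges\<close>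

definition inner_triangle :: "(real^2) set" where
  "inner_triangle = {x. sqrt 3 - 2 \<le> sa x \<and> sqrt 3 - 2 \<le> sb x \<and> sqrt 3 - 2 \<le> sc x}"

lemma inner_triangle_subset: "inner_triangle \<subseteq> triangle"
proof
  fix x assume "x \<in> inner_triangle"
  then show "x \<in> triangle"
    \<comment> \<open>Each coordinate is at most \<open>2 * (2 - sqrt 3)\<close>, which
      \<open>3/2 \<le> sqrt 3\<close> puts below 1.\<close>
    using s_sum[of x] real_le_rsqrt[of "3/2" 3] unfolding inner_triangle_def triangle_def
    by (auto simp: power2_eq_square)
qed

lemma affine_has_derivative:
  fixes f :: "real^'n::finite \<Rightarrow> real^'m::finite"
  assumes "open U" "x \<in> U" "\<And>y. y \<in> U \<Longrightarrow> f y = A *v y + b"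
  shows "(f has_derivative ((*v) A)) (at x)"
proof -
  have "((\<lambda>y. A *v y + b) has_derivative ((*v) A)) (at x)"
    by (auto intro!: derivative_eq_intros bounded_linear.has_derivative[OF matrix_vector_mul_bounded_linear])
  then show ?thesis
    by (rule has_derivative_transform_within_open[OF _ assms(1,2)]) (simp add: assms(3))
qed

text \<open>Off the edge lines \<open>x\<close> lies in one of eight open regions: the exterior, the
  inner triangle, three edge regions and three corner regions. On each the map is affine, and the
  derivative is its linear part.\<close>

lemma star_derivative:
  assumes g: "generic x"
  obtains A where "(star \<epsilon> has_derivative (*v) A) (at x)"
    and "x \<notin> triangle \<Longrightarrow> A = 0" "x \<in> inner_triangle \<Longrightarrow> sym_part A = 0"
    and "x \<in> triangle - inner_triangle \<Longrightarrow> sym_part A \<in> wells \<epsilon>"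
proof -
  note mat = vec_eq_iff forall_2 matrix_vector_mult_def sum_2 sym_part_def transpose_def wells_def s_defs r_simps
  note op = open_Collect_less open_Collect_conj open_Collect_disj continuous_intros
  \<comment> \<open>Genericity makes every inequality strict, hence every region open.\<close>
  have cases: "1 < sa x \<or> 1 < sb x \<or> 1 < sc x \<or> 
     (sqrt 3 - 2 < sa x \<and> sqrt 3 - 2 < sb x \<and> sqrt 3 - 2 < sc x) \<or>
     (sa x < 1 \<and> sb x - (1 + sqrt 3) * sa x + sqrt 3 < 0 \<and> sc x - (1 + sqrt 3) * sa x + sqrt 3 < 0) \<or>
     (sb x < 1 \<and> sc x - (1 + sqrt 3) * sb x + sqrt 3 < 0 \<and> sa x - (1 + sqrt 3) * sb x + sqrt 3 < 0) \<or>
     (sc x < 1 \<and> sa x - (1 + sqrt 3) * sc x + sqrt 3 < 0 \<and> sb x - (1 + sqrt 3) * sc x + sqrt 3 < 0) \<or>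
     (sc x < sqrt 3 - 2 \<and> 0 < sa x - (1 + sqrt 3) * sb x + sqrt 3 \<and> 0 < sb x - (1 + sqrt 3) * sa x + sqrt 3) \<or>
     (sa x < sqrt 3 - 2 \<and> 0 < sb x - (1 + sqrt 3) * sc x + sqrt 3 \<and> 0 < sc x - (1 + sqrt 3) * sb x + sqrt 3) \<or>
     (sb x < sqrt 3 - 2 \<and> 0 < sc x - (1 + sqrt 3) * sa x + sqrt 3 \<and> 0 < sa x - (1 + sqrt 3) * sc x + sqrt 3)"
    using annulus_cases[of "sa x" "sb x" "sc x"] annulus_cases[of "sb x" "sc x" "sa x"]
      annulus_cases[of "sc x" "sa x" "sb x"] s_sum[of x] g unfolding generic_def by argo
  \<comment> \<open>\<open>edge\<close> keeps the edge regions out of the inner triangle;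
    \<open>edge'\<close> and \<open>corner\<close> place the edge and corner regions in the outer
    one.\<close>
  have edge: False if "a + b + c = 0" "b - (1 + sqrt 3) * a + sqrt 3 < 0" "sqrt 3 - 2 \<le> b" "sqrt 3 - 2 \<le> c"
    for a b c :: real
  proof -
    have "(1 + sqrt 3) * a \<le> (1 + sqrt 3) * (2 * (2 - sqrt 3))"
      using that sqrt3 by (intro mult_left_mono) auto
    then show False using that(2,3) sqrt3(1) by (simp add: algebra_simps)
  qed
  have edge': "b \<le> 1" if "a < 1" "b - (1 + sqrt 3) * a + sqrt 3 < 0" for a b :: real
  proof -
    have "(1 + sqrt 3) * a \<le> (1 + sqrt 3) * 1" using that sqrt3 by (intro mult_left_mono) auto
    then show ?thesis using that by simp
  qed
  have corner: "a \<le> 1" if "0 < a - (1 + sqrt 3) * b + sqrt 3" "0 < b - (1 + sqrt 3) * a + sqrt 3" for a b :: real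
  proof (rule ccontr)
    assume "\<not> a \<le> 1"
    then have "(3 + 2 * sqrt 3) * a > (3 + 2 * sqrt 3) * 1" by (intro mult_strict_left_mono) (auto intro: add_pos_nonneg)
    moreover have "(1 + sqrt 3) * (b - (1 + sqrt 3) * a + sqrt 3) > 0"
      using that sqrt3 by simp
    ultimately show False using that(1) sqrt3(1) by (simp add: algebra_simps)
  qed
  consider "1 < sa x \<or> 1 < sb x \<or> 1 < sc x"
    | "sqrt 3 - 2 < sa x" "sqrt 3 - 2 < sb x" "sqrt 3 - 2 < sc x"
    | "sa x < 1" "sb x - (1 + sqrt 3) * sa x + sqrt 3 < 0" "sc x - (1 + sqrt 3) * sa x + sqrt 3 < 0"
    | "sb x < 1" "sc x - (1 + sqrt 3) * sb x + sqrt 3 < 0" "sa x - (1 + sqrt 3) * sb x + sqrt 3 < 0"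
    | "sc x < 1" "sa x - (1 + sqrt 3) * sc x + sqrt 3 < 0" "sb x - (1 + sqrt 3) * sc x + sqrt 3 < 0"
    | "sc x < sqrt 3 - 2" "0 < sa x - (1 + sqrt 3) * sb x + sqrt 3" "0 < sb x - (1 + sqrt 3) * sa x + sqrt 3"
    | "sa x < sqrt 3 - 2" "0 < sb x - (1 + sqrt 3) * sc x + sqrt 3" "0 < sc x - (1 + sqrt 3) * sb x + sqrt 3"
    | "sb x < sqrt 3 - 2" "0 < sc x - (1 + sqrt 3) * sa x + sqrt 3" "0 < sa x - (1 + sqrt 3) * sc x + sqrt 3"
    using cases by blast
  then show thesis
  proof cases
    case 1
    show thesis
    proof (rule that)
      show "(star \<epsilon> has_derivative (*v) 0) (at x)"
        by (rule affine_has_derivative[where U="{y. 1 < sa y \<or> 1 < sb y \<or> 1 < sc y}" and b=0])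
          (use 1 in \<open>auto intro!: op simp: star_outside\<close>)
    qed (use 1 inner_triangle_subset in \<open>auto simp: triangle_def subset_iff\<close>)
  next
    case 2
    show thesis
    proof (rule that)
      show "(star \<epsilon> has_derivative (*v) ((\<epsilon> * sqrt 3) *\<^sub>R vector [vector [0, 1], vector [-1, 0]])) (at x)"
        by (rule affine_has_derivative[where U="{y. sqrt 3 - 2 < sa y \<and> sqrt 3 - 2 < sb y \<and> sqrt 3 - 2 < sc y}" and b=0])
          (use 2 in \<open>auto intro!: op simp: star_inside mat\<close>)
    qed (use 2 inner_triangle_subset in \<open>auto simp: inner_triangle_def subset_iff mat\<close>)
  next
    case 3
    then have "x \<in> triangle" "x \<notin> inner_triangle"
      using edge[of "sa x" "sb x" "sc x"] edge'[of "sa x" "sb x"] edge'[of "sa x" "sc x"] s_sum[of x]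
      unfolding triangle_def inner_triangle_def by auto
    show thesis
    proof (rule that)
      show "(star \<epsilon> has_derivative (*v) (\<epsilon> *\<^sub>R vector [vector [1, -1], vector [1, -1]])) (at x)"
        by (rule affine_has_derivative[where U="{x. sa x < 1 \<and> sb x - (1 + sqrt 3) * sa x + sqrt 3 < 0 \<and> sc x - (1 + sqrt 3) * sa x + sqrt 3 < 0}" 
            and b = "- \<epsilon> *\<^sub>R vector [1, 1]"])
          (use 3 in \<open>auto intro!: op simp: star_edge_a, auto simp: mat\<close>)
    qed (use \<open>x \<in> triangle\<close> \<open>x \<notin> inner_triangle\<close> in \<open>auto simp: mat\<close>)
  next
    case 4
    then have "x \<in> triangle" "x \<notin> inner_triangle"
      using edge[of "sb x" "sc x" "sa x"] edge'[of "sb x" "sc x"] edge'[of "sb x" "sa x"] s_sum[of x]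
      unfolding triangle_def inner_triangle_def by auto
    show thesis
    proof (rule that)
      show "(star \<epsilon> has_derivative (*v) (\<epsilon> *\<^sub>R vector [vector [-1/2, - 1 - sqrt 3 / 2], vector [1 - sqrt 3 / 2, 1/2]])) (at x)"
        by (rule affine_has_derivative[where U="{x. sb x < 1 \<and> sc x - (1 + sqrt 3) * sb x + sqrt 3 < 0 \<and> sa x - (1 + sqrt 3) * sb x + sqrt 3 < 0}" 
            and b = "- \<epsilon> *\<^sub>R vector [- (sqrt 3 + 1) / 2, (sqrt 3 - 1) / 2]"])
          (use 4 in \<open>auto intro!: op simp: star_edge_b, auto simp: mat\<close>)
    qed (use \<open>x \<in> triangle\<close> \<open>x \<notin> inner_triangle\<close> in \<open>auto simp: mat\<close>)
  next
    case 5
    then have "x \<in> triangle" "x \<notin> inner_triangle"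
      using edge[of "sc x" "sa x" "sb x"] edge'[of "sc x" "sa x"] edge'[of "sc x" "sb x"] s_sum[of x]
      unfolding triangle_def inner_triangle_def by auto
    show thesis
    proof (rule that)
      show "(star \<epsilon> has_derivative (*v) (\<epsilon> *\<^sub>R vector [vector [-1/2, - 1 + sqrt 3 / 2], vector [1 + sqrt 3 / 2, 1/2]])) (at x)"
        by (rule affine_has_derivative[where U="{x. sc x < 1 \<and> sa x - (1 + sqrt 3) * sc x + sqrt 3 < 0 \<and> sb x - (1 + sqrt 3) * sc x + sqrt 3 < 0}" 
            and b = "- \<epsilon> *\<^sub>R vector [(sqrt 3 - 1) / 2, - (sqrt 3 + 1) / 2]"])
          (use 5 in \<open>auto intro!: op simp: star_edge_c, auto simp: mat\<close>)
    qed (use \<open>x \<in> triangle\<close> \<open>x \<notin> inner_triangle\<close> in \<open>auto simp: mat\<close>)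
  next
    case 6
    then have "x \<in> triangle" "x \<notin> inner_triangle"
      using corner[of "sa x" "sb x"] corner[of "sb x" "sa x"] sqrt3
      unfolding triangle_def inner_triangle_def by auto
    show thesis
    proof (rule that)
      show "(star \<epsilon> has_derivative (*v) (\<epsilon> *\<^sub>R vector [vector [-1/2, 3 * sqrt 3 / 2 - 1], vector [1 - sqrt 3 / 2, 1/2]])) (at x)"
        by (rule affine_has_derivative[where U="{x. sc x < sqrt 3 - 2 \<and> 0 < sa x - (1 + sqrt 3) * sb x + sqrt 3 \<and> 0 < sb x - (1 + sqrt 3) * sa x + sqrt 3}" 
            and b = "\<epsilon> *\<^sub>R vector [(3 * sqrt 3 - 5) / 2, (1 - sqrt 3) / 2]"])
          (use 6 in \<open>auto intro!: op simp: star_corner_ab, auto simp: mat\<close>)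
    qed (use \<open>x \<in> triangle\<close> \<open>x \<notin> inner_triangle\<close> in \<open>auto simp: mat\<close>)
  next
    case 7
    then have "x \<in> triangle" "x \<notin> inner_triangle"
      using corner[of "sb x" "sc x"] corner[of "sc x" "sb x"] sqrt3
      unfolding triangle_def inner_triangle_def by auto
    show thesis
    proof (rule that)
      show "(star \<epsilon> has_derivative (*v) (\<epsilon> *\<^sub>R vector [vector [1, sqrt 3 - 1], vector [1 - sqrt 3, -1]])) (at x)"
        by (rule affine_has_derivative[where U="{x. sa x < sqrt 3 - 2 \<and> 0 < sb x - (1 + sqrt 3) * sc x + sqrt 3 \<and> 0 < sc x - (1 + sqrt 3) * sb x + sqrt 3}" 
            and b = "\<epsilon> *\<^sub>R vector [2 - sqrt 3, 2 - sqrt 3]"])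
          (use 7 in \<open>auto intro!: op simp: star_corner_bc, auto simp: mat\<close>)
    qed (use \<open>x \<in> triangle\<close> \<open>x \<notin> inner_triangle\<close> in \<open>auto simp: mat\<close>)
  next
    case 8
    then have "x \<in> triangle" "x \<notin> inner_triangle"
      using corner[of "sc x" "sa x"] corner[of "sa x" "sc x"] sqrt3
      unfolding triangle_def inner_triangle_def by auto
    show thesis
    proof (rule that)
      show "(star \<epsilon> has_derivative (*v) (\<epsilon> *\<^sub>R vector [vector [-1/2, sqrt 3 / 2 - 1], vector [1 - 3 * sqrt 3 / 2, 1/2]])) (at x)"
        by (rule affine_has_derivative[where U="{x. sb x < sqrt 3 - 2 \<and> 0 < sc x - (1 + sqrt 3) * sa x + sqrt 3 \<and> 0 < sa x - (1 + sqrt 3) * sc x + sqrt 3}" 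
            and b = "\<epsilon> *\<^sub>R vector [(1 - sqrt 3) / 2, (3 * sqrt 3 - 5) / 2]"])
          (use 8 in \<open>auto intro!: op simp: star_corner_ca, auto simp: mat\<close>)
    qed (use \<open>x \<in> triangle\<close> \<open>x \<notin> inner_triangle\<close> in \<open>auto simp: mat\<close>)
  qed
qed

text \<open>All hats are maxima and minima of affine functions, so the closure rules
  suffice.\<close>

lemma star_lipschitzian: "lipschitzian (star \<epsilon>)"
proof -
  note intros = lipschitzian_add lipschitzian_diff lipschitzian_minus lipschitzian_scaleR lipschitzian_scaleR_left
    lipschitzian_mult lipschitzian_divide lipschitzian_min lipschitzian_max lipschitzian_nth lipschitzian_const
  have "lipschitzian sa" "lipschitzian sb" "lipschitzian sc"
    unfolding sa_def[abs_def] sb_def[abs_def] sc_def[abs_def] by (intro intros)+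
  then show ?thesis
    unfolding star_def[abs_def] hat_def by (intro intros)
qed

section \<open>Size and symmetry of \<open>star\<close>, and negligibility of the edges\<close>

lemma norm_le_of_triangle:
  assumes "x \<in> triangle"
  shows "norm x \<le> 4"
proof -
  \<comment> \<open>Since the projections onto the normals sum to 3 times the identity,
    \<open>x\<close> is one third of the combination of the normals with coefficients
    \<open>sa x\<close>, \<open>sb x\<close>, \<open>sc x\<close>.\<close>
  have x: "x$1 = (2 * sa x + (sqrt 3 - 1) * sb x - (sqrt 3 + 1) * sc x) / 6"
    "x$2 = (- 2 * sa x + (sqrt 3 + 1) * sb x - (sqrt 3 - 1) * sc x) / 6"
    unfolding s_defs by (simp_all add: r_simps)
  have s: "\<bar>sa x\<bar> \<le> 2" "\<bar>sb x\<bar> \<le> 2" "\<bar>sc x\<bar> \<le> 2"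
    using assms s_sum[of x] unfolding triangle_def by auto
  have *: "\<bar>(sqrt 3 - 1) * t\<bar> \<le> 2" "\<bar>(sqrt 3 + 1) * t\<bar> \<le> 6" if "\<bar>t\<bar> \<le> 2" for t :: real
  proof -
    have "\<bar>(sqrt 3 - 1)\<bar> * \<bar>t\<bar> \<le> 1 * 2" "\<bar>(sqrt 3 + 1)\<bar> * \<bar>t\<bar> \<le> 3 * 2"
      using that sqrt3 by (intro mult_mono; simp)+
    then show "\<bar>(sqrt 3 - 1) * t\<bar> \<le> 2" "\<bar>(sqrt 3 + 1) * t\<bar> \<le> 6" by (simp_all add: abs_mult)
  qed
  have "\<bar>(2 * a + p - q) / 6\<bar> \<le> 2" "\<bar>(- 2 * a + q - p) / 6\<bar> \<le> 2"
    if "\<bar>a\<bar> \<le> 2" "\<bar>p\<bar> \<le> 2" "\<bar>q\<bar> \<le> 6" for a p q :: real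
    using that by (auto simp: abs_le_iff)
  then have "\<bar>x$1\<bar> \<le> 2" "\<bar>x$2\<bar> \<le> 2"
    unfolding x using *[OF s(2)] *[OF s(3)] s(1) by blast+
  then show ?thesis using norm_le_l1_cart[of x] by (simp add: sum_2)
qed

text \<open>The triangle has inradius \<open>1 / sqrt 2\<close>, which leaves room for the rounder
  radius \<open>1/2\<close>.\<close>

lemma triangle_of_norm_le:
  assumes "norm x \<le> 1/2"
  shows "x \<in> triangle"
proof -
  have x: "\<bar>x$1\<bar> \<le> 1/2" "\<bar>x$2\<bar> \<le> 1/2"
    using component_le_norm_cart[of x 1] component_le_norm_cart[of x 2] assms by linarith+
  have *: "\<bar>(sqrt 3 - 1) * t\<bar> \<le> (sqrt 3 - 1) / 2" "\<bar>(sqrt 3 + 1) * t\<bar> \<le> (sqrt 3 + 1) / 2" if "\<bar>t\<bar> \<le> 1/2" for t :: real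
  proof -
    have "\<bar>(sqrt 3 - 1)\<bar> * \<bar>t\<bar> \<le> (sqrt 3 - 1) * (1/2)" "\<bar>(sqrt 3 + 1)\<bar> * \<bar>t\<bar> \<le> (sqrt 3 + 1) * (1/2)"
      using that sqrt3 by (intro mult_mono; simp)+
    then show "\<bar>(sqrt 3 - 1) * t\<bar> \<le> (sqrt 3 - 1) / 2" "\<bar>(sqrt 3 + 1) * t\<bar> \<le> (sqrt 3 + 1) / 2"
      by (simp_all add: abs_mult)
  qed
  have **: "(p + q) / 2 \<le> 1" "- (q + p) / 2 \<le> 1"
    if "\<bar>p\<bar> \<le> (sqrt 3 - 1) / 2" "\<bar>q\<bar> \<le> (sqrt 3 + 1) / 2" for p q :: real
    using that sqrt3 by (auto simp: abs_le_iff)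
  show ?thesis
    unfolding triangle_def mem_Collect_eq s_defs
  proof (intro conjI)
    show "x$1 - x$2 \<le> 1" using x by linarith
  qed (rule **; rule *; rule x)+
qed

lemma star_bounded:
  obtains K where "\<And>x. norm (star \<epsilon> x) \<le> K"
proof -
  obtain C where C: "C-lipschitz_on UNIV (star \<epsilon>)"
    using star_lipschitzian[of \<epsilon>] unfolding lipschitzian_def by (rule exE)
  have "compact (star \<epsilon> ` cball 0 4)"
    by (intro compact_continuous_image continuous_on_subset[OF lipschitz_on_continuous_on[OF C]]) auto
  then have "bounded (star \<epsilon> ` cball 0 4)" by (rule compact_imp_bounded)
  then obtain K where K: "K > 0" "\<And>x. norm x \<le> 4 \<Longrightarrow> norm (star \<epsilon> x) \<le> K"
    unfolding bounded_pos by auto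
  have "norm (star \<epsilon> x) \<le> K" for x
  proof (cases "x \<in> triangle")
    case False
    then have "star \<epsilon> x = 0" by (intro star_outside) (auto simp: triangle_def)
    then show ?thesis using K(1) by simp
  qed (use K(2) norm_le_of_triangle in blast)
  then show thesis by (rule that)
qed

definition Q :: "real^2^2" where
  "Q = vector [vector [-1/2, - (sqrt 3 / 2)], vector [sqrt 3 / 2, -1/2]]"

lemma Q_orthogonal: "orthogonal_transformation ((*v) Q)"
  unfolding orthogonal_transformation_matrix matrix_of_matrix_vector_mul orthogonal_matrix
  by (auto simp: Q_def matrix_matrix_mult_def mat_def vec_eq_iff forall_2 sum_2 transpose_def)

text \<open>The 120 degree rotation \<open>Q\<close> permutes \<open>sa\<close>, \<open>sb\<close>,
  \<open>sc\<close> cyclically, hence the three hats, and moves the attached vectors in the matching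
  way.\<close>

lemma star_rotation: "star \<epsilon> (Q *v x) = Q *v star \<epsilon> x"
proof -
  have s: "sa (Q *v x) = sc x" "sb (Q *v x) = sa x" "sc (Q *v x) = sb x"
    unfolding Q_def s_defs by (simp_all add: matrix_vector_mult_def sum_2 r_simps)
  show ?thesis
    unfolding star_def s by (simp add: Q_def matrix_vector_mult_def vec_eq_iff forall_2 sum_2 r_simps)
qed

lemma negligible_line:
  fixes p q t :: real
  assumes "p \<noteq> 0 \<or> q \<noteq> 0"
  shows "negligible {x::real^2. p * x$1 + q * x$2 = t}"
proof -
  have "negligible {x. (vector [p, q] :: real^2) \<bullet> x = t}"
    using assms by (intro negligible_hyperplane) (auto simp: vec_eq_iff forall_2)
  then show ?thesis by (simp add: inner_vec_def sum_2)
qed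

lemma generic_AE:
  assumes "c \<noteq> 0"
  shows "AE x in lebesgue. generic (c *\<^sub>R x)"
proof -
  have "negligible {x. \<alpha> * sa (c *\<^sub>R x) + \<beta> * sb (c *\<^sub>R x) = t}" if "\<alpha> \<noteq> 0 \<or> \<beta> \<noteq> 0" for \<alpha> \<beta> t
  proof -
    have "\<alpha> * sa (c *\<^sub>R x) + \<beta> * sb (c *\<^sub>R x) = (c * (\<alpha> + \<beta> * (sqrt 3 - 1) / 2)) * x$1
      + (c * (- \<alpha> + \<beta> * (sqrt 3 + 1) / 2)) * x$2" for x
      unfolding s_defs by (simp add: r_simps)
    moreover have "\<alpha> + \<beta> * (sqrt 3 - 1) / 2 \<noteq> 0 \<or> - \<alpha> + \<beta> * (sqrt 3 + 1) / 2 \<noteq> 0"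
    proof (rule ccontr)
      assume "\<not> ?thesis"
      then have "\<alpha> + \<beta> * (sqrt 3 - 1) / 2 = 0" "- \<alpha> + \<beta> * (sqrt 3 + 1) / 2 = 0" by auto
      moreover have "\<beta> * sqrt 3 = (\<alpha> + \<beta> * (sqrt 3 - 1) / 2) + (- \<alpha> + \<beta> * (sqrt 3 + 1) / 2)"
        by (simp add: field_simps)
      ultimately show False using that by auto
    qed
    ultimately show ?thesis using negligible_line assms by simp
  qed
  then have line: "AE x in lebesgue. \<alpha> * sa (c *\<^sub>R x) + \<beta> * sb (c *\<^sub>R x) \<noteq> t" if "\<alpha> \<noteq> 0 \<or> \<beta> \<noteq> 0" for \<alpha> \<beta> t
    using that AE_not_in[of "{x. \<alpha> * sa (c *\<^sub>R x) + \<beta> * sb (c *\<^sub>R x) = t}" lebesgue]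
    by (simp add: negligible_iff_null_sets)
  \<comment> \<open>As \<open>sa\<close>, \<open>sb\<close>, \<open>sc\<close> sum to zero, a
    combination of them is a nontrivial linear form unless its three coefficients agree. Eliminating
    \<open>sc\<close> reduces to \<open>line\<close>.\<close>
  have ae: "AE x in lebesgue. P (c *\<^sub>R x)"
    if nz: "\<alpha> \<noteq> \<gamma> \<or> \<beta> \<noteq> \<gamma>" and P: "\<And>y. P y \<or> \<alpha> * sa y + \<beta> * sb y + \<gamma> * sc y = t" for \<alpha> \<beta> \<gamma> t P
  proof -
    have sc: "sc y = - sa y - sb y" for y using s_sum[of y] by simp
    have "AE x in lebesgue. (\<alpha> - \<gamma>) * sa (c *\<^sub>R x) + (\<beta> - \<gamma>) * sb (c *\<^sub>R x) \<noteq> t"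
      by (rule line) (use nz in auto)
    then show ?thesis
    proof eventually_elim
      case (elim x)
      then show ?case using P[of "c *\<^sub>R x"] by (auto simp: sc algebra_simps)
    qed
  qed
  have nz: "1 + sqrt 3 \<noteq> 0" "- 1 - sqrt 3 \<noteq> 1" using sqrt3 by auto
  \<comment> \<open>The coefficients are instantiated in the order \<open>\<alpha>\<close>,
    \<open>\<gamma>\<close>, \<open>\<beta>\<close>.\<close>
  note ae' = ae[of 1 0 0 _ 1] ae[of 0 0 1 _ 1] ae[of 0 1 0 _ 1]
    ae[of 1 0 0 _ "sqrt 3 - 2"] ae[of 0 0 1 _ "sqrt 3 - 2"] ae[of 0 1 0 _ "sqrt 3 - 2"]
  show ?thesis
    unfolding generic_def
  proof (intro AE_conjI)
    show "AE x in lebesgue. sa (c *\<^sub>R x) - (1 + sqrt 3) * sb (c *\<^sub>R x) + sqrt 3 \<noteq> 0"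
      by (rule ae[of 1 0 "- 1 - sqrt 3" _ "- sqrt 3"]) (use nz in \<open>auto simp: algebra_simps\<close>)
    show "AE x in lebesgue. sb (c *\<^sub>R x) - (1 + sqrt 3) * sa (c *\<^sub>R x) + sqrt 3 \<noteq> 0"
      by (rule ae[of "- 1 - sqrt 3" 0 1 _ "- sqrt 3"]) (use nz in \<open>auto simp: algebra_simps\<close>)
    show "AE x in lebesgue. sb (c *\<^sub>R x) - (1 + sqrt 3) * sc (c *\<^sub>R x) + sqrt 3 \<noteq> 0"
      by (rule ae[of 0 "- 1 - sqrt 3" 1 _ "- sqrt 3"]) (use nz in \<open>auto simp: algebra_simps\<close>)
    show "AE x in lebesgue. sc (c *\<^sub>R x) - (1 + sqrt 3) * sb (c *\<^sub>R x) + sqrt 3 \<noteq> 0"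
      by (rule ae[of 0 1 "- 1 - sqrt 3" _ "- sqrt 3"]) (use nz in \<open>auto simp: algebra_simps\<close>)
    show "AE x in lebesgue. sc (c *\<^sub>R x) - (1 + sqrt 3) * sa (c *\<^sub>R x) + sqrt 3 \<noteq> 0"
      by (rule ae[of "- 1 - sqrt 3" 1 0 _ "- sqrt 3"]) (use nz in \<open>auto simp: algebra_simps\<close>)
    show "AE x in lebesgue. sa (c *\<^sub>R x) - (1 + sqrt 3) * sc (c *\<^sub>R x) + sqrt 3 \<noteq> 0"
      by (rule ae[of 1 "- 1 - sqrt 3" 0 _ "- sqrt 3"]) (use nz in \<open>auto simp: algebra_simps\<close>)
  qed (rule ae'; simp)+
qed

text \<open>Dividing by the negative number \<open>sqrt 3 - 2\<close> turns the lower bounds into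
  the upper bounds.\<close>

lemma inner_triangle_iff: "x \<in> inner_triangle \<longleftrightarrow> (1 / (sqrt 3 - 2)) *\<^sub>R x \<in> triangle"
proof -
  have "sqrt 3 - 2 < 0" using sqrt3(3) by simp
  then show ?thesis
    unfolding inner_triangle_def triangle_def by (simp add: s_scaleR divide_le_eq)
qed

section \<open>Superposition of the nested copies\<close>

locale nested_stars =
  fixes \<epsilon> \<rho> :: real
  assumes eps: "\<epsilon> > 0" and rho: "\<rho> > 0"
begin

text \<open>The sign of \<open>sqrt 3 - 2\<close> encodes the half turn between consecutive triangles.\<close>
definition scale :: "nat \<Rightarrow> real" where "scale k = \<rho> * (sqrt 3 - 2) ^ k"

definition layer :: "nat \<Rightarrow> real^2 \<Rightarrow> real^2" where
  "layer k x = scale k *\<^sub>R star \<epsilon> ((1 / scale k) *\<^sub>R x)"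

definition partial :: "nat \<Rightarrow> real^2 \<Rightarrow> real^2" where
  "partial n x = (\<Sum>k<n. layer k x)"

definition nested :: "real^2 \<Rightarrow> real^2" where
  "nested x = (\<Sum>k. layer k x)"

definition in_triangle :: "nat \<Rightarrow> real^2 \<Rightarrow> bool" where
  "in_triangle k x \<longleftrightarrow> (1 / scale k) *\<^sub>R x \<in> triangle"

section \<open>Scales and nesting of the triangles\<close>

lemma scale_neq_0: "scale k \<noteq> 0"
  using rho sqrt3(3) unfolding scale_def by simp

lemma abs_scale: "\<bar>scale k\<bar> = \<rho> * (2 - sqrt 3) ^ k"
  using rho sqrt3(3) unfolding scale_def by (simp add: abs_mult power_abs)

lemma abs_scale_le: "\<bar>scale k\<bar> \<le> \<rho> * (1/2) ^ k"
proof -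
  have "2 - sqrt 3 \<le> 1/2" using real_le_rsqrt[of "3/2" 3] by (simp add: power2_eq_square)
  then have "(2 - sqrt 3) ^ k \<le> (1/2) ^ k" using sqrt3 by (intro power_mono) auto
  then show ?thesis unfolding abs_scale using rho by (intro mult_left_mono) auto
qed

text \<open>Consecutive scales differ by the factor \<open>sqrt 3 - 2\<close>, so the inner triangle
  of one copy is the outer triangle of the next.\<close>

lemma in_triangle_Suc: "in_triangle (Suc k) x \<longleftrightarrow> (1 / scale k) *\<^sub>R x \<in> inner_triangle"
  unfolding in_triangle_def inner_triangle_iff by (simp add: scale_def mult_ac)

lemma in_triangle_antimono: "in_triangle l x \<Longrightarrow> k \<le> l \<Longrightarrow> in_triangle k x"
proof (induction l)
  case (Suc l)
  then have "in_triangle l x"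
    using inner_triangle_subset by (auto simp: in_triangle_Suc in_triangle_def[of l])
  then show ?case using Suc by (auto simp: le_Suc_eq)
qed simp

lemma norm_le_of_in_triangle:
  assumes "in_triangle k x"
  shows "norm x \<le> 4 * \<rho> * (1/2) ^ k"
proof -
  have "norm ((1 / scale k) *\<^sub>R x) \<le> 4"
    using assms norm_le_of_triangle unfolding in_triangle_def by blast
  then have "norm x \<le> 4 * \<bar>scale k\<bar>"
    using scale_neq_0[of k] by (simp add: field_simps)
  then show ?thesis using abs_scale_le[of k] by simp
qed

lemma layer_outside: "\<not> in_triangle k x \<Longrightarrow> layer k x = 0"
  unfolding layer_def in_triangle_def by (subst star_outside) (auto simp: triangle_def)

lemma layer_inside: "in_triangle (Suc k) x \<Longrightarrow> layer k x = (\<epsilon> * sqrt 3) *\<^sub>R vector [x$2, - x$1]"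
  unfolding layer_def in_triangle_Suc
  by (subst star_inside) (auto simp: inner_triangle_def vec_eq_iff forall_2 scale_neq_0)

text \<open>The triangles shrink to the origin. As \<open>m\<close> is uniform outside a ball, the
  series is one fixed finite sum in a whole neighbourhood of any nonzero point.\<close>

lemma layer_eventually_zero:
  assumes "d > 0"
  obtains m where "\<And>k x. k \<ge> m \<Longrightarrow> norm x > d \<Longrightarrow> \<not> in_triangle k x"
proof -
  have "(\<lambda>k. 4 * \<rho> * (1/2::real) ^ k) \<longlonglongrightarrow> 0"
    by (intro tendsto_mult_right_zero LIMSEQ_power_zero) simp
  then have "\<forall>\<^sub>F k in sequentially. 4 * \<rho> * (1/2::real) ^ k < d"
    using assms by (rule order_tendstoD(2))
  then obtain m where m: "\<And>k. k \<ge> m \<Longrightarrow> 4 * \<rho> * (1/2::real) ^ k < d"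
    unfolding eventually_sequentially by blast
  show thesis
  proof (rule that[of m], rule notI)
    fix k x assume "k \<ge> m" "norm x > d" "in_triangle k x"
    then show False using m[of k] norm_le_of_in_triangle[of k x] by simp
  qed
qed

lemma nested_eq_partial:
  assumes "\<And>k. k \<ge> m \<Longrightarrow> \<not> in_triangle k x"
  shows "nested x = partial m x"
  unfolding nested_def partial_def
  by (rule suminf_finite) (use assms layer_outside in auto)

section \<open>Convergence of the series of layers\<close>

lemma layer_bounded:
  obtains K where "K > 0" "\<And>k x. norm (layer k x) \<le> K * (1/2) ^ k"
proof -
  obtain K where K: "\<And>x. norm (star \<epsilon> x) \<le> K" using star_bounded[of \<epsilon>] by metis
  have K0: "K \<ge> 0" using K[of 0] norm_ge_zero order_trans by blast
  show thesis
  proof (rule that[of "K * \<rho> + 1"])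
    show "norm (layer k x) \<le> (K * \<rho> + 1) * (1/2) ^ k" for k x
    proof -
      have "norm (layer k x) \<le> (\<rho> * (1/2) ^ k) * K"
        unfolding layer_def norm_scaleR
        by (intro mult_mono abs_scale_le K) (use rho in auto)
      also have "\<dots> \<le> (K * \<rho> + 1) * (1/2) ^ k" by (simp add: algebra_simps)
      finally show ?thesis .
    qed
    show "0 < K * \<rho> + 1" using K0 rho by (simp add: add_nonneg_pos)
  qed
qed

text \<open>Argument and value are scaled by reciprocal factors, so one constant serves all
  layers.\<close>

lemma layer_lipschitz:
  assumes "C-lipschitz_on UNIV (star \<epsilon>)"
  shows "C-lipschitz_on UNIV (layer k)"
proof (rule lipschitz_onI)
  fix x y
  have "dist (layer k x) (layer k y) = \<bar>scale k\<bar> * dist (star \<epsilon> ((1 / scale k) *\<^sub>R x)) (star \<epsilon> ((1 / scale k) *\<^sub>R y))"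
    unfolding layer_def by (simp add: dist_norm flip: scaleR_diff_right)
  also have "\<dots> \<le> \<bar>scale k\<bar> * (C * dist ((1 / scale k) *\<^sub>R x) ((1 / scale k) *\<^sub>R y))"
    by (intro mult_left_mono lipschitz_onD[OF assms]) auto
  also have "dist ((1 / scale k) *\<^sub>R x) ((1 / scale k) *\<^sub>R y) = dist x y / \<bar>scale k\<bar>"
    by (simp add: dist_norm divide_inverse mult.commute flip: scaleR_diff_right)
  finally show "dist (layer k x) (layer k y) \<le> C * dist x y"
    using scale_neq_0[of k] by (simp add: field_simps)
qed (rule lipschitz_on_nonneg[OF assms])

lemma partial_lipschitz:
  assumes "C-lipschitz_on UNIV (star \<epsilon>)"
  shows "(real n * C)-lipschitz_on UNIV (partial n)"
proof (induction n)
  case (Suc n)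
  then show ?case
    using lipschitz_on_add[OF Suc layer_lipschitz[OF assms, of n]]
    by (simp add: partial_def[abs_def] algebra_simps)
qed (simp add: partial_def[abs_def] lipschitz_on_constant)

text \<open>The layers decay geometrically in the supremum norm, so the Weierstrass test gives
  uniform convergence, which yields the continuity of the sum.\<close>

lemma partial_bounded:
  obtains K where "\<And>n x. norm (partial n x) \<le> K" "\<And>x. norm (nested x) \<le> K"
    "\<And>x. (\<lambda>n. partial n x) \<longlonglongrightarrow> nested x" "continuous_on UNIV nested"
proof -
  obtain K where K: "K > 0" "\<And>k x. norm (layer k x) \<le> K * (1/2) ^ k"
    using layer_bounded by metis
  have s: "summable (\<lambda>k. K * (1/2::real) ^ k)" by (intro summable_mult summable_geometric) simp
  have un: "uniform_limit UNIV partial nested sequentially"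
    using Weierstrass_m_test[where A=UNIV, OF K(2) s]
    unfolding partial_def[abs_def] nested_def[abs_def] .
  have lim: "(\<lambda>n. partial n x) \<longlonglongrightarrow> nested x" for x
    using tendsto_uniform_limitI[OF un] by simp
  have b: "norm (partial n x) \<le> (\<Sum>k. K * (1/2::real) ^ k)" for n x
  proof -
    have "norm (partial n x) \<le> (\<Sum>k<n. K * (1/2::real) ^ k)"
      unfolding partial_def by (rule sum_norm_le) (rule K(2))
    also have "\<dots> \<le> (\<Sum>k. K * (1/2::real) ^ k)"
      by (rule sum_le_suminf[OF s]) (use K in auto)
    finally show ?thesis .
  qed
  obtain C where C: "C-lipschitz_on UNIV (star \<epsilon>)"
    using star_lipschitzian[of \<epsilon>] unfolding lipschitzian_def by (rule exE)
  have "continuous_on UNIV nested"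
    by (rule uniform_limit_theorem[OF always_eventually un])
      (use lipschitz_on_continuous_on[OF partial_lipschitz[OF C]] in auto)
  moreover have "norm (nested x) \<le> (\<Sum>k. K * (1/2::real) ^ k)" for x
    by (rule LIMSEQ_le_const2[OF tendsto_norm[OF lim]]) (use b in auto)
  ultimately show thesis using that b lim by blast
qed

section \<open>The derivative of the sum at almost every point\<close>

definition regular :: "real^2 \<Rightarrow> bool" where
  "regular x \<longleftrightarrow> x \<noteq> 0 \<and> (\<forall>k. generic ((1 / scale k) *\<^sub>R x))"

text \<open>Each of the countably many copies contributes a null set of edge lines. The origin is
  generic for every copy, yet the triangles accumulate there, so it is excluded separately.\<close>

lemma regular_AE: "AE x in lebesgue. regular x"
proof -
  have "AE x::real^2 in lebesgue. x \<noteq> 0"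
    using AE_not_in[of "{0::real^2}" lebesgue] by (simp flip: negligible_iff_null_sets)
  moreover have "AE x in lebesgue. \<forall>k. generic ((1 / scale k) *\<^sub>R x)"
    unfolding AE_all_countable using generic_AE scale_neq_0 by simp
  ultimately show ?thesis unfolding regular_def by eventually_elim simp
qed

text \<open>Partial sums and limit share the matrices \<open>A k\<close>: from index
  \<open>m\<close> on the layers vanish near \<open>x\<close>, so the series is differentiated
  termwise as a finite sum.\<close>

lemma regular_derivative:
  assumes x: "regular x"
  obtains A m where "\<And>n. (partial n has_derivative (*v) (\<Sum>k<n. A k)) (at x)"
    and "\<And>n. n \<ge> m \<Longrightarrow> (nested has_derivative (*v) (\<Sum>k<n. A k)) (at x)"
    and "\<And>k. \<not> in_triangle k x \<Longrightarrow> A k = 0"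
    and "\<And>k. in_triangle (Suc k) x \<Longrightarrow> sym_part (A k) = 0"
    and "\<And>k. in_triangle k x \<Longrightarrow> \<not> in_triangle (Suc k) x \<Longrightarrow> sym_part (A k) \<in> wells \<epsilon>"
    and "\<And>k. (layer k has_derivative (*v) (A k)) (at x)"
    and "\<And>k. k \<ge> m \<Longrightarrow> \<not> in_triangle k x"
proof -
  have "\<exists>A. (layer k has_derivative (*v) A) (at x) \<and> (\<not> in_triangle k x \<longrightarrow> A = 0) \<and>
     (in_triangle (Suc k) x \<longrightarrow> sym_part A = 0) \<and>
     (in_triangle k x \<and> \<not> in_triangle (Suc k) x \<longrightarrow> sym_part A \<in> wells \<epsilon>)" for k
  proof -
    have "generic ((1 / scale k) *\<^sub>R x)" using x unfolding regular_def by blast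
    then obtain A where A: "(star \<epsilon> has_derivative (*v) A) (at ((1 / scale k) *\<^sub>R x))"
      "(1 / scale k) *\<^sub>R x \<notin> triangle \<Longrightarrow> A = 0" "(1 / scale k) *\<^sub>R x \<in> inner_triangle \<Longrightarrow> sym_part A = 0"
      "(1 / scale k) *\<^sub>R x \<in> triangle - inner_triangle \<Longrightarrow> sym_part A \<in> wells \<epsilon>"
      using star_derivative[of "(1 / scale k) *\<^sub>R x" \<epsilon>] by metis
    have "((\<lambda>y. star \<epsilon> ((1 / scale k) *\<^sub>R y)) has_derivative (\<lambda>h. A *v ((1 / scale k) *\<^sub>R h))) (at x)"
      by (rule has_derivative_compose[of "\<lambda>y. (1 / scale k) *\<^sub>R y" _ x UNIV "star \<epsilon>" "(*v) A"])
        (use A(1) in \<open>auto intro!: derivative_eq_intros\<close>)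
    then have "(layer k has_derivative (\<lambda>h. scale k *\<^sub>R (A *v ((1 / scale k) *\<^sub>R h)))) (at x)"
      unfolding layer_def[abs_def] by (intro has_derivative_scaleR_right)
    then have "(layer k has_derivative (*v) A) (at x)"
      using scale_neq_0[of k] by (simp add: matrix_vector_mult_scaleR)
    then show ?thesis
      by (intro exI[of _ A] conjI impI) (use A(2-4) in \<open>auto simp: in_triangle_Suc in_triangle_def[of k]\<close>)
  qed
  then obtain A where A: "\<And>k. (layer k has_derivative (*v) (A k)) (at x)" "\<And>k. \<not> in_triangle k x \<Longrightarrow> A k = 0"
    "\<And>k. in_triangle (Suc k) x \<Longrightarrow> sym_part (A k) = 0"
    "\<And>k. in_triangle k x \<Longrightarrow> \<not> in_triangle (Suc k) x \<Longrightarrow> sym_part (A k) \<in> wells \<epsilon>"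
    by metis
  have sum: "(\<Sum>k<n. A k *v h) = (\<Sum>k<n. A k) *v h" for n h
    by (induction n) (simp_all add: matrix_vector_mult_add_rdistrib)
  have p: "(partial n has_derivative (*v) (\<Sum>k<n. A k)) (at x)" for n
    using has_derivative_sum[of "{..<n}" layer "\<lambda>k. (*v) (A k)", OF A(1)]
    unfolding partial_def[abs_def] sum .
  \<comment> \<open>Half the norm leaves an open neighbourhood of \<open>x\<close> on which the
    layers from \<open>m\<close> on vanish.\<close>
  have "norm x / 2 > 0" using x unfolding regular_def by simp
  then obtain m where m: "\<And>k y. k \<ge> m \<Longrightarrow> norm y > norm x / 2 \<Longrightarrow> \<not> in_triangle k y"
    using layer_eventually_zero by metis
  have d: "(nested has_derivative (*v) (\<Sum>k<n. A k)) (at x)" if "n \<ge> m" for n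
  proof (rule has_derivative_transform_within_open[OF p[of n]])
    show "open {y::real^2. norm y > norm x / 2}"
      by (intro open_Collect_less continuous_intros)
    show "x \<in> {y. norm y > norm x / 2}" using x unfolding regular_def by simp
    fix y :: "real^2" assume "y \<in> {y. norm y > norm x / 2}"
    then show "partial n y = nested y" using m that by (intro nested_eq_partial[symmetric]) auto
  qed
  have "\<not> in_triangle k x" if "k \<ge> m" for k using m[OF that, of x] x unfolding regular_def by simp
  from that[OF p d A(2,3,4,1) this] show thesis by blast
qed

section \<open>Equivariance under the rotation by 120 degrees\<close>

lemma nested_rotation: "nested (Q *v x) = Q *v nested x"
proof -
  obtain K where lim: "\<And>x. (\<lambda>n. partial n x) \<longlonglongrightarrow> nested x" using partial_bounded by metis
  have "layer k (Q *v x) = Q *v layer k x" for k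
    unfolding layer_def by (simp add: star_rotation flip: matrix_vector_mult_scaleR)
  then have "partial n (Q *v x) = Q *v partial n x" for n
    unfolding partial_def by (induction n) (simp_all add: matrix_vector_right_distrib)
  moreover have "(\<lambda>n. Q *v partial n x) \<longlonglongrightarrow> Q *v nested x"
    by (rule bounded_linear.tendsto[OF matrix_vector_mul_bounded_linear lim])
  ultimately show ?thesis using LIMSEQ_unique[OF lim] by simp
qed

lemma Q_inverse: "transpose Q ** Q = mat 1" "Q ** transpose Q = mat 1"
  using Q_orthogonal orthogonal_transformation_matrix[of "(*v) Q"]
  by (simp_all add: orthogonal_matrix_def)

text \<open>Chain rule for the identity that conjugating \<open>nested\<close> with \<open>Q\<close>
  gives \<open>nested\<close> again.\<close>

lemma grad_rotation:
  assumes "nested differentiable (at x)"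
  shows "grad nested (Q *v x) = Q ** grad nested x ** transpose Q"
proof (rule grad_eq)
  have t: "transpose Q *v (Q *v y) = y" "Q *v (transpose Q *v y) = y" for y
    by (simp_all only: matrix_vector_mul_assoc Q_inverse matrix_vector_mul_lid)
  have "((\<lambda>y. transpose Q *v y) has_derivative (*v) (transpose Q)) (at (Q *v x))"
    by (rule bounded_linear_imp_has_derivative[OF matrix_vector_mul_bounded_linear])
  moreover have "(nested has_derivative (*v) (grad nested x)) (at (transpose Q *v (Q *v x)))"
    unfolding t using assms by (rule grad_has_derivative)
  ultimately have "((\<lambda>y. nested (transpose Q *v y)) has_derivative (\<lambda>h. grad nested x *v (transpose Q *v h))) (at (Q *v x))"
    by (rule has_derivative_compose)
  then have "((\<lambda>y. Q *v nested (transpose Q *v y)) has_derivative (\<lambda>h. Q *v (grad nested x *v (transpose Q *v h)))) (at (Q *v x))"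
    by (rule bounded_linear.has_derivative[OF matrix_vector_mul_bounded_linear])
  moreover have "(\<lambda>y. Q *v nested (transpose Q *v y)) = nested"
    by (rule ext) (simp only: nested_rotation[symmetric] t)
  ultimately have "(nested has_derivative (\<lambda>h. Q *v (grad nested x *v (transpose Q *v h)))) (at (Q *v x))"
    by simp
  then show "(nested has_derivative (*v) (Q ** grad nested x ** transpose Q)) (at (Q *v x))"
    by (simp only: matrix_vector_mul_assoc matrix_mul_assoc)
qed

lemma sym_part_rotation: "sym_part (Q ** M ** transpose Q) = Q ** sym_part M ** transpose Q"
  unfolding sym_part_def
  by (simp add: vec_eq_iff forall_2 matrix_matrix_mult_def sum_2 transpose_def algebra_simps)

text \<open>
  Only the layers whose triangle contains \<open>x\<close> contribute to the gradient at \<open>x\<close>, so its entries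
  are at most \<open>C\<close> times their number, which is \<open>Suc k\<close> for the largest index \<open>k\<close> of such a layer.
\<close>
definition dominating :: "real \<Rightarrow> real \<Rightarrow> real^2 \<Rightarrow> real" where
  "dominating C p x = (\<Sum>k. (C * real (Suc k)) powr p * indicator (cball 0 (4 * \<rho> * (1/2) ^ k)) x)"

text \<open>Only finitely many of the shrinking balls contain a given nonzero point.\<close>

lemma dominating_summable:
  fixes x :: "real^2"
  assumes "x \<noteq> 0"
  shows "summable (\<lambda>k. (C * real (Suc k)) powr p * indicator (cball 0 (4 * \<rho> * (1/2) ^ k)) x :: real)"
proof -
  have "(\<lambda>k. 4 * \<rho> * (1/2::real) ^ k) \<longlonglongrightarrow> 0"
    by (intro tendsto_mult_right_zero LIMSEQ_power_zero) simp
  then have "\<forall>\<^sub>F k in sequentially. 4 * \<rho> * (1/2::real) ^ k < norm x"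
    using assms by (intro order_tendstoD(2)) auto
  then have "\<forall>\<^sub>F k in sequentially. (C * real (Suc k)) powr p * indicator (cball 0 (4 * \<rho> * (1/2) ^ k)) x = (0::real)"
    by eventually_elim (simp add: indicator_def)
  then have "summable (\<lambda>k. (C * real (Suc k)) powr p * indicator (cball 0 (4 * \<rho> * (1/2) ^ k)) x :: real)
      \<longleftrightarrow> summable (\<lambda>_::nat. 0::real)"
    by (rule summable_cong)
  then show ?thesis by simp
qed

text \<open>The areas of the balls decay like \<open>(1/4) ^ k\<close>, which beats the polynomial
  growth of the coefficients. The sum of the integrals is therefore finite for every exponent
  \<open>p\<close>.\<close>

lemma dominating_integrable: "integrable lebesgue (dominating C p)"
  unfolding dominating_def[abs_def]
proof (rule integrable_suminf)
  show "integrable lebesgue (\<lambda>x::real^2. (C * real (Suc k)) powr p * indicator (cball 0 (4 * \<rho> * (1/2) ^ k)) x :: real)" for k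
    by (rule integrable_const_cball)
  have "AE x::real^2 in lebesgue. x \<noteq> 0"
    using AE_not_in[of "{0::real^2}" lebesgue] by (simp flip: negligible_iff_null_sets)
  then show "AE x::real^2 in lebesgue. summable (\<lambda>k. norm ((C * real (Suc k)) powr p * indicator (cball 0 (4 * \<rho> * (1/2) ^ k)) x :: real))"
    by eventually_elim (use dominating_summable in \<open>simp add: abs_mult\<close>)
  have "(LINT x::real^2|lebesgue. norm ((C * real (Suc k)) powr p * indicator (cball 0 (4 * \<rho> * (1/2) ^ k)) x :: real))
    = (C * real (Suc k)) powr p * (pi * (4 * \<rho> * (1/2) ^ k)\<^sup>2)" for k
    using rho content_cball[where 'a="real^2", of "4 * \<rho> * (1/2) ^ k" 0]
    by (simp add: abs_mult unit_ball_vol_2 del: of_nat_Suc)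
  moreover have "summable (\<lambda>k. (C * real (Suc k)) powr p * (pi * (4 * \<rho> * (1/2) ^ k)\<^sup>2))"
  proof (rule summable_comparison_test_bigo)
    show "summable (\<lambda>k. norm ((1/2::real) ^ k))" by (simp add: summable_geometric)
    have *: "(\<lambda>k. real (Suc k) powr p * ((1/2) ^ k)\<^sup>2) \<in> O(\<lambda>k. (1/2::real) ^ k)"
      by real_asymp
    show "(\<lambda>k. (C * real (Suc k)) powr p * (pi * (4 * \<rho> * (1/2) ^ k)\<^sup>2)) \<in> O(\<lambda>k. (1/2::real) ^ k)"
    proof -
      have "(\<lambda>k. (C * real (Suc k)) powr p * (pi * (4 * \<rho> * (1/2) ^ k)\<^sup>2))
        = (\<lambda>k. (C powr p * pi * 16 * \<rho>\<^sup>2) * (real (Suc k) powr p * ((1/2) ^ k)\<^sup>2))"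
        by (auto simp: powr_mult power_mult_distrib mult_ac simp del: of_nat_Suc)
      then show ?thesis using * by simp
    qed
  qed
  ultimately show "summable (\<lambda>k. LINT x::real^2|lebesgue. norm ((C * real (Suc k)) powr p * indicator (cball 0 (4 * \<rho> * (1/2) ^ k)) x :: real))"
    by (simp only:)
qed

lemma regular_bound:
  assumes x: "regular x" and C: "C-lipschitz_on UNIV (star \<epsilon>)" and p: "p \<ge> 1"
    and A: "\<And>k. (layer k has_derivative (*v) (A k)) (at x)" "\<And>k. \<not> in_triangle k x \<Longrightarrow> A k = 0"
    and m: "\<And>k. k \<ge> m \<Longrightarrow> \<not> in_triangle k x"
  shows "\<bar>(\<Sum>k<n. A k) $ i $ j\<bar> powr p \<le> dominating C p x"
proof -
  have C0: "C \<ge> 0" using lipschitz_on_nonneg[OF C] .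
  have x0: "x \<noteq> 0" using x unfolding regular_def by blast
  have s: "summable (\<lambda>k. (C * real (Suc k)) powr p * indicator (cball 0 (4 * \<rho> * (1/2) ^ k)) x :: real)"
    by (rule dominating_summable[OF x0])
  \<comment> \<open>By nesting, \<open>l\<close> is the number of triangles that contain
    \<open>x\<close>.\<close>
  define l where "l = (LEAST k. \<not> in_triangle k x)"
  have l: "\<not> in_triangle l x" "\<And>k. k < l \<Longrightarrow> in_triangle k x"
    unfolding l_def using LeastI[of "\<lambda>k. \<not> in_triangle k x" m] m[of m] not_less_Least by blast+
  have out: "A k = 0" if "k \<ge> l" for k
    using l(1) in_triangle_antimono[of k x l] that A(2) by blast
  have "\<bar>(\<Sum>k<n. A k) $ i $ j\<bar> \<le> C * real l"
  proof -
    have "(\<Sum>k<n. A k) = (\<Sum>k\<in>{..<n} \<inter> {..<l}. A k)"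
      by (rule sum.mono_neutral_right) (use out not_le in blast)+
    then have "\<bar>(\<Sum>k<n. A k) $ i $ j\<bar> = \<bar>\<Sum>k\<in>{..<n} \<inter> {..<l}. A k $ i $ j\<bar>" by simp
    also have "\<dots> \<le> (\<Sum>k\<in>{..<n} \<inter> {..<l}. C)"
      by (rule order_trans[OF sum_abs]) (intro sum_mono lipschitz_matrix_bound[OF layer_lipschitz[OF C] A(1)])
    also have "\<dots> = C * real (card ({..<n} \<inter> {..<l}))" by simp
    also have "\<dots> \<le> C * real l"
      using card_mono[of "{..<l}" "{..<n} \<inter> {..<l}"] C0 by (intro mult_left_mono) auto
    finally show ?thesis .
  qed
  then have le: "\<bar>(\<Sum>k<n. A k) $ i $ j\<bar> powr p \<le> (C * real l) powr p"
    using p by (intro powr_mono2) auto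
  also have "\<dots> \<le> dominating C p x"
  proof (cases l)
    \<comment> \<open>No layer is active, and \<open>0 powr p\<close> is \<open>0\<close>.\<close>
    case 0
    have "0 \<le> dominating C p x"
      unfolding dominating_def by (rule suminf_nonneg[OF s]) auto
    then show ?thesis using 0 by simp
  next
    \<comment> \<open>The single term with index \<open>q\<close> already equals the bound.\<close>
    case (Suc q)
    have "x \<in> cball 0 (4 * \<rho> * (1/2) ^ q)"
      using norm_le_of_in_triangle[OF l(2)[of q]] Suc by simp
    then have "(C * real l) powr p = (\<Sum>k\<in>{q}. (C * real (Suc k)) powr p * indicator (cball 0 (4 * \<rho> * (1/2) ^ k)) x)"
      using Suc by simp
    also have "\<dots> \<le> dominating C p x"
      unfolding dominating_def by (rule sum_le_suminf[OF s]) auto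
    finally show ?thesis .
  qed
  finally show ?thesis .
qed

lemma regular_grad:
  assumes x: "regular x" and C: "C-lipschitz_on UNIV (star \<epsilon>)" and p: "p \<ge> 1"
  shows "nested differentiable (at x)" "\<bar>grad nested x $ i $ j\<bar> powr p \<le> dominating C p x"
    and "partial n differentiable (at x)" "\<bar>grad (partial n) x $ i $ j\<bar> powr p \<le> dominating C p x"
    and "(\<lambda>n. grad (partial n) x $ i $ j) \<longlonglongrightarrow> grad nested x $ i $ j"
    and "in_triangle 0 x \<Longrightarrow> sym_part (grad nested x) \<in> wells \<epsilon>"
proof -
  obtain A m where p': "\<And>n. (partial n has_derivative (*v) (\<Sum>k<n. A k)) (at x)"
    and d: "\<And>n. n \<ge> m \<Longrightarrow> (nested has_derivative (*v) (\<Sum>k<n. A k)) (at x)"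
    and A: "\<And>k. \<not> in_triangle k x \<Longrightarrow> A k = 0"
      "\<And>k. in_triangle (Suc k) x \<Longrightarrow> sym_part (A k) = 0"
      "\<And>k. in_triangle k x \<Longrightarrow> \<not> in_triangle (Suc k) x \<Longrightarrow> sym_part (A k) \<in> wells \<epsilon>"
      "\<And>k. (layer k has_derivative (*v) (A k)) (at x)"
      "\<And>k. k \<ge> m \<Longrightarrow> \<not> in_triangle k x"
    by (rule regular_derivative[OF x]) (rule that)
  note b = regular_bound[OF x C p A(4,1,5)]
  show "nested differentiable (at x)" "partial n differentiable (at x)"
    using d[of m] p'[of n] unfolding differentiable_def by blast+
  show "\<bar>grad nested x $ i $ j\<bar> powr p \<le> dominating C p x"
    unfolding grad_eq[OF d[OF order_refl]] by (rule b) auto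
  show "\<bar>grad (partial n) x $ i $ j\<bar> powr p \<le> dominating C p x"
    unfolding grad_eq[OF p'] by (rule b) auto
  show "(\<lambda>n. grad (partial n) x $ i $ j) \<longlonglongrightarrow> grad nested x $ i $ j"
  proof (rule tendsto_eventually)
    show "\<forall>\<^sub>F n in sequentially. grad (partial n) x $ i $ j = grad nested x $ i $ j"
      using eventually_ge_at_top[of m] by eventually_elim (simp add: grad_eq[OF d] grad_eq[OF p'])
  qed
  show "sym_part (grad nested x) \<in> wells \<epsilon>" if "in_triangle 0 x"
  proof -
    define l where "l = (LEAST k. \<not> in_triangle k x)"
    have l: "\<not> in_triangle l x" "\<And>k. k < l \<Longrightarrow> in_triangle k x"
      unfolding l_def using LeastI[of "\<lambda>k. \<not> in_triangle k x" m] A(5)[of m] not_less_Least by blast+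
    have "l \<noteq> 0" using l(1) that by metis
    then obtain q where q: "l = Suc q" using not0_implies_Suc by blast
    have out: "A k = 0" if "k \<ge> l" for k
      using l(1) in_triangle_antimono[of k x l] that A(1) by blast
    have "sym_part (\<Sum>k<N. A k) = (\<Sum>k<N. sym_part (A k))" for N
    proof (induction N)
      case 0
      show ?case by (simp add: sym_part_def transpose_def vec_eq_iff)
    next
      case (Suc N)
      have "sym_part (M + M') = sym_part M + sym_part M'" for M M' :: "real^2^2"
        by (simp add: sym_part_def transpose_def vec_eq_iff forall_2 algebra_simps add_divide_distrib)
      then show ?case using Suc by simp
    qed
    \<comment> \<open>Layers below \<open>q\<close> act as infinitesimal rotations at
      \<open>x\<close> and layers from \<open>l\<close> on vanish, so only the innermost triangle
      around \<open>x\<close> determines the strain. The range must reach \<open>l\<close> to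
      include \<open>q\<close>, and \<open>m\<close> to represent the derivative of
      \<open>nested\<close>.\<close>
    moreover have "(\<Sum>k<max l m. sym_part (A k)) = (\<Sum>k\<in>{q}. sym_part (A k))"
    proof (rule sum.mono_neutral_right)
      show "\<forall>k\<in>{..<max l m} - {q}. sym_part (A k) = 0"
      proof
        fix k assume "k \<in> {..<max l m} - {q}"
        then have "Suc k < l \<or> k \<ge> l" using q by auto
        then show "sym_part (A k) = 0"
          using A(2) l(2) out by (auto simp: sym_part_def transpose_def vec_eq_iff)
      qed
    qed (use q in auto)
    ultimately have "sym_part (grad nested x) = sym_part (A q)"
      using grad_eq[OF d[of "max l m"]] by simp
    then show ?thesis using A(3)[of q] l q by simp
  qed
qed

section \<open>Sobolev regularity and failure of the Lipschitz condition\<close>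

lemma nested_continuous: "continuous_on UNIV nested"
  by (rule partial_bounded)

lemma nested_bounded:
  obtains K where "\<And>x. norm (nested x) \<le> K"
  by (rule partial_bounded) (rule that)

lemma ae_component_derivative:
  fixes f :: "real^2 \<Rightarrow> real^2"
  assumes "\<And>x. regular x \<Longrightarrow> f differentiable (at x)"
  shows "AE x in lebesgue. \<exists>D. ((\<lambda>x. f x $ i) has_derivative D) (at x) \<and> grad f x $ i $ j = D (axis j 1)"
  using regular_AE
proof eventually_elim
  case (elim x)
  from has_derivative_component[OF grad_has_derivative[OF assms[OF elim]], of i]
  show ?case by (auto simp: matrix_axis)
qed

text \<open>Integration by parts holds for the Lipschitz partial sums and passes to the limit. The
  gradients of all partial sums have the common majorant \<open>dominating C 1\<close>, and the case
  of general \<open>p\<close> gives the integrability of the powers.\<close>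

lemma grad_nested_measurable: "(\<lambda>x. grad nested x $ i $ j) \<in> borel_measurable lebesgue"
  and grad_nested_integrable: "p \<ge> 1 \<Longrightarrow> integrable lebesgue (\<lambda>x. \<bar>grad nested x $ i $ j\<bar> powr p)"
  and nested_weak_gradient: "has_weak_gradient \<Omega> nested (grad nested)"
proof -
  obtain C where C: "C-lipschitz_on UNIV (star \<epsilon>)"
    using star_lipschitzian[of \<epsilon>] unfolding lipschitzian_def by (rule exE)
  obtain K where K: "\<And>n x. norm (partial n x) \<le> K" "\<And>x. norm (nested x) \<le> K"
    "\<And>x. (\<lambda>n. partial n x) \<longlonglongrightarrow> nested x" "continuous_on UNIV nested"
    by (rule partial_bounded) (rule that)
  note R = regular_grad[OF _ C]
  have cn: "continuous_on UNIV (\<lambda>x. nested x $ i)" for i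
    using K(4) by (intro continuous_intros)
  have lp: "(real n * C)-lipschitz_on UNIV (\<lambda>x. partial n x $ i)" for n i
    by (rule lipschitz_nth[OF partial_lipschitz[OF C]])
  have cp: "continuous_on UNIV (\<lambda>x. partial n x $ i)" for n i
    by (rule lipschitz_on_continuous_on[OF lp])
  have aen: "AE x in lebesgue. \<exists>D. ((\<lambda>x. nested x $ i) has_derivative D) (at x) \<and> grad nested x $ i $ j = D (axis j 1)" for i j
    by (rule ae_component_derivative) (rule R(1)[of _ 1], simp_all)
  have aep: "AE x in lebesgue. \<exists>D. ((\<lambda>x. partial n x $ i) has_derivative D) (at x) \<and> grad (partial n) x $ i $ j = D (axis j 1)" for n i j
    by (rule ae_component_derivative) (rule R(3)[of _ 1], simp_all)
  have mg: "(\<lambda>x. grad nested x $ i $ j) \<in> borel_measurable lebesgue" for i j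
    using cn aen by (rule partial_measurable)
  then show "(\<lambda>x. grad nested x $ i $ j) \<in> borel_measurable lebesgue" .
  have gp: "integrable lebesgue (\<lambda>x. \<bar>grad nested x $ i $ j\<bar> powr p)" if "p \<ge> 1" for p i j
  proof (rule Bochner_Integration.integrable_bound[OF dominating_integrable[of C p]])
    show "AE x in lebesgue. norm (\<bar>grad nested x $ i $ j\<bar> powr p) \<le> norm (dominating C p x)"
      using regular_AE by eventually_elim (use R(2)[OF _ that, of _ i j] in \<open>force simp: abs_le_iff\<close>)
  qed (use mg in simp)
  then show "p \<ge> 1 \<Longrightarrow> integrable lebesgue (\<lambda>x. \<bar>grad nested x $ i $ j\<bar> powr p)" by blast
  have gi: "integrable lebesgue (\<lambda>x. grad nested x $ i $ j)" for i j
    using gp[of 1 i j] mg by (simp add: integrable_abs_iff)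
  show "has_weak_gradient \<Omega> nested (grad nested)"
    unfolding has_weak_gradient_def
  proof (intro allI)
    fix i j
    show "has_weak_partial \<Omega> j (\<lambda>x. nested x $ i) (\<lambda>x. grad nested x $ i $ j)"
    proof (rule weak_partial_limit[where fn="\<lambda>n x. partial n x $ i" and gn="\<lambda>n x. grad (partial n) x $ i $ j"
          and K=K and H="dominating C 1"])
      show "locally_integrable \<Omega> (\<lambda>x. nested x $ i)" by (rule continuous_locally_integrable[OF cn])
      show "locally_integrable \<Omega> (\<lambda>x. grad nested x $ i $ j)" by (rule integrable_locally_integrable[OF gi])
      show "(\<lambda>x. partial n x $ i) \<in> borel_measurable lebesgue" for n
        by (rule measurable_lebesgue_continuous[OF cp])
      show "(\<lambda>x. nested x $ i) \<in> borel_measurable lebesgue"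
        by (rule measurable_lebesgue_continuous[OF cn])
      show "(\<lambda>x. grad (partial n) x $ i $ j) \<in> borel_measurable lebesgue" for n
        using cp aep by (rule partial_measurable)
      show "(LINT x|lebesgue. partial n x $ i * partial_deriv j \<phi> x) = - (LINT x|lebesgue. grad (partial n) x $ i $ j * \<phi> x)"
        if "test_function \<Omega> \<phi>" for n \<phi>
        by (rule lipschitz_integration_by_parts[OF lp that aep])
      show "AE x in lebesgue. (\<lambda>n. partial n x $ i) \<longlonglongrightarrow> nested x $ i"
        using K(3) by (intro always_eventually allI tendsto_vec_nth)
      show "AE x in lebesgue. \<bar>partial n x $ i\<bar> \<le> K" for n
        using K(1) by (intro always_eventually allI order_trans[OF component_le_norm_cart])
      show "AE x in lebesgue. (\<lambda>n. grad (partial n) x $ i $ j) \<longlonglongrightarrow> grad nested x $ i $ j"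
        using regular_AE by eventually_elim (rule R(5)[of _ 1], simp_all)
      show "AE x in lebesgue. \<bar>grad (partial n) x $ i $ j\<bar> \<le> dominating C 1 x" for n
        using regular_AE by eventually_elim (use R(4)[of _ 1 n i j] in simp)
      show "integrable lebesgue (dominating C 1)" by (rule dominating_integrable)
    qed (use mg in auto)
  qed
qed

lemma nested_in_W1p:
  assumes "p \<ge> 1" "\<Omega> \<in> sets lebesgue" "bounded \<Omega>"
  shows "in_W1p p \<Omega> nested"
  unfolding in_W1p_def
proof (intro conjI exI[of _ "grad nested"] allI)
  obtain K where K: "\<And>x. norm (nested x) \<le> K"
    using nested_bounded by metis
  have m: "nested \<in> borel_measurable lebesgue" by (rule measurable_lebesgue_continuous[OF nested_continuous])
  have on: "f \<in> borel_measurable (lebesgue_on \<Omega>)" if "f \<in> borel_measurable lebesgue" for f :: "real^2 \<Rightarrow> 'a::topological_space"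
    using that by (rule measurable_restrict_space1)
  have int: "integrable (lebesgue_on \<Omega>) f" if "integrable lebesgue (\<lambda>x. indicator \<Omega> x *\<^sub>R f x)" for f :: "real^2 \<Rightarrow> real"
    using that assms(2) by (simp add: integrable_restrict_space)
  have "\<bar>norm (nested x) powr p\<bar> \<le> K powr p" for x
    using K[of x] assms(1) by (simp add: powr_mono2)
  then have "integrable lebesgue (\<lambda>x. indicator \<Omega> x *\<^sub>R (norm (nested x) powr p))"
    using assms m by (intro integrable_bounded_set) auto
  then show "in_Lp p \<Omega> nested" unfolding in_Lp_def by (intro conjI on[OF m] int)
  show "has_weak_gradient \<Omega> nested (grad nested)" by (rule nested_weak_gradient)
  fix i j
  have "integrable lebesgue (\<lambda>x. indicator \<Omega> x *\<^sub>R (norm (grad nested x $ i $ j) powr p))"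
    using grad_nested_integrable[OF assms(1), of i j] assms(2) by (intro integrable_mult_indicator) auto
  then show "in_Lp p \<Omega> (\<lambda>x. grad nested x $ i $ j)"
    unfolding in_Lp_def by (intro conjI on[OF grad_nested_measurable] int)
qed

text \<open>On the boundary of the triangle with index \<open>k\<close> the preceding
  \<open>k\<close> layers have added the same infinitesimal rotation. So \<open>nested\<close>
  stretches the distance to the origin by \<open>k * \<epsilon> * sqrt 3\<close> there, however
  small that triangle is.\<close>

lemma nested_not_lipschitz:
  assumes "d > 0"
  shows "\<not> (\<exists>C. C-lipschitz_on (ball 0 d) nested)"
proof
  assume "\<exists>C. C-lipschitz_on (ball 0 d) nested"
  then obtain C where C: "C-lipschitz_on (ball 0 d) nested" ..
  \<comment> \<open>The midpoint of the side \<open>sa = 1\<close>: \<open>star\<close> vanishes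
    there, and it lies outside the inner triangle.\<close>
  define y :: "real^2" where "y = vector [1/2, -1/2]"
  have y: "sa y = 1" "sb y = -1/2" "sc y = -1/2" "y \<noteq> 0"
    unfolding y_def s_defs by (simp_all add: vec_eq_iff forall_2 algebra_simps add_divide_distrib)
  define x where "x k = scale k *\<^sub>R y" for k
  have inv: "(1 / scale k) *\<^sub>R x k = y" for k unfolding x_def using scale_neq_0 by simp
  have r: "-1/2 < sqrt (3::real) - 2" using real_less_rsqrt[of "3/2" 3] by (simp add: power2_eq_square)
  have nested_x: "nested (x k) = real k *\<^sub>R ((\<epsilon> * sqrt 3) *\<^sub>R vector [x k $ 2, - x k $ 1])" for k
  proof -
    have i: "in_triangle k (x k)" unfolding in_triangle_def inv by (simp add: triangle_def y)
    have "\<not> in_triangle (Suc k) (x k)" unfolding in_triangle_Suc inv using r by (simp add: inner_triangle_def y)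
    then have "nested (x k) = partial (Suc k) (x k)"
      by (intro nested_eq_partial) (use in_triangle_antimono in blast)
    moreover have "layer k (x k) = 0" unfolding layer_def inv by (simp add: star_outside y)
    moreover have "layer l (x k) = (\<epsilon> * sqrt 3) *\<^sub>R vector [x k $ 2, - x k $ 1]" if "l < k" for l
      by (rule layer_inside) (use in_triangle_antimono[OF i, of "Suc l"] that in simp)
    ultimately show ?thesis by (simp add: partial_def sum_constant_scaleR del: sum_constant)
  qed
  have "in_triangle k 0" for k unfolding in_triangle_def by (simp add: triangle_def s_defs)
  then have "layer k 0 = 0" for k by (subst layer_inside) (auto simp: vec_eq_iff forall_2)
  then have nested_0: "nested 0 = 0" unfolding nested_def by simp
  have "\<forall>\<^sub>F k in sequentially. \<rho> * norm y * (1/2::real) ^ k < d"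
    using assms by (intro order_tendstoD(2)[of _ 0] tendsto_mult_right_zero LIMSEQ_power_zero) auto
  moreover have "\<forall>\<^sub>F k in sequentially. C < real k * (\<epsilon> * sqrt 3)"
  proof -
    have "filterlim (\<lambda>k. (\<epsilon> * sqrt 3) * real k) at_top sequentially"
      using eps by (intro filterlim_tendsto_pos_mult_at_top[OF tendsto_const] filterlim_real_sequentially) auto
    then show ?thesis by (simp add: filterlim_at_top_dense mult.commute)
  qed
  ultimately obtain k where k: "\<rho> * norm y * (1/2::real) ^ k < d" "C < real k * (\<epsilon> * sqrt 3)"
    using eventually_happens'[OF sequentially_bot eventually_conj] by blast
  have n: "norm (vector [z $ 2, - z $ 1] :: real^2) = norm z" for z :: "real^2"
    by (simp add: norm_vec_def L2_set_def sum_2 add.commute)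
  have "norm (x k) \<le> (\<rho> * (1/2) ^ k) * norm y"
    unfolding x_def norm_scaleR real_norm_def by (intro mult_right_mono abs_scale_le) auto
  then have "x k \<in> ball 0 d" using k(1) by (simp add: mult_ac)
  then have "norm (nested (x k)) \<le> C * norm (x k)"
    using lipschitz_onD[OF C, of "x k" 0] assms by (simp add: nested_0)
  then have "real k * (\<epsilon> * sqrt 3) * norm (x k) \<le> C * norm (x k)"
    using eps by (simp add: nested_x n abs_mult)
  moreover have "norm (x k) > 0" using y(4) scale_neq_0 unfolding x_def by simp
  ultimately show False using k(2) by simp
qed

section \<open>The areas of the three phases\<close>

lemma nested_strain:
  assumes "norm x \<le> \<rho> / 2" "regular x"
  shows "sym_part (grad nested x) \<in> wells \<epsilon>"
proof -
  obtain C where C: "C-lipschitz_on UNIV (star \<epsilon>)"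
    using star_lipschitzian[of \<epsilon>] unfolding lipschitzian_def by (rule exE)
  have "norm ((1 / scale 0) *\<^sub>R x) \<le> 1/2" using assms(1) rho by (simp add: scale_def field_simps)
  then have "in_triangle 0 x" unfolding in_triangle_def by (rule triangle_of_norm_le)
  then show ?thesis by (rule regular_grad(6)[OF assms(2) C order_refl])
qed

definition phase :: "real \<Rightarrow> real^2^2 \<Rightarrow> (real^2) set" where
  "phase R E = {x \<in> ball 0 R. sym_part (grad nested x) = E}"

lemma phase_lmeasurable: "phase R E \<in> lmeasurable"
proof (rule bounded_set_imp_lmeasurable)
  let ?f = "\<lambda>i j x. (1/2) * (grad nested x $ i $ j + grad nested x $ j $ i)"
  have "?f i j \<in> borel_measurable lebesgue" for i j
    by (intro borel_measurable_times borel_measurable_add grad_nested_measurable borel_measurable_const)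
  then have "?f i j -` {E $ i $ j} \<inter> space lebesgue \<in> sets lebesgue" for i j
    by (rule measurable_sets) simp
  then have "(\<Inter>i. \<Inter>j. ?f i j -` {E $ i $ j} \<inter> space lebesgue) \<inter> ball 0 R \<in> sets lebesgue"
    by (intro sets.Int sets.finite_INT) auto
  also have "(\<Inter>i. \<Inter>j. ?f i j -` {E $ i $ j} \<inter> space lebesgue) \<inter> ball 0 R = phase R E"
    unfolding phase_def by (auto simp: sym_part_def transpose_def vec_eq_iff)
  finally show "phase R E \<in> sets lebesgue" .
  show "bounded (phase R E)" by (rule bounded_subset[OF bounded_ball[of 0 R]]) (auto simp: phase_def)
qed

text \<open>\<open>Q\<close> preserves area and the centred ball, and it conjugates the strain. An
  inequality is enough because the three wells form a cycle.\<close>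

lemma phase_rotation_le:
  assumes "E \<noteq> 0"
  shows "measure lebesgue (phase R E) \<le> measure lebesgue (phase R (Q ** E ** transpose Q))"
proof (rule measure_le_of_orthogonal_image[OF Q_orthogonal phase_lmeasurable phase_lmeasurable])
  show "(*v) Q ` phase R E \<subseteq> phase R (Q ** E ** transpose Q)"
  proof (rule image_subsetI)
    fix x assume "x \<in> phase R E"
    then have x: "norm x < R" "sym_part (grad nested x) = E" by (auto simp: phase_def)
    \<comment> \<open>Where the derivative fails to exist, \<open>grad\<close> is 0 by convention,
      so a nonzero strain certifies differentiability.\<close>
    have "nested differentiable (at x)"
      using x(2) assms by (rule_tac ccontr) (simp add: grad_def sym_part_def transpose_def vec_eq_iff)
    then show "Q *v x \<in> phase R (Q ** E ** transpose Q)"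
      using x orthogonal_transformation_norm[OF Q_orthogonal, of x]
      by (simp add: phase_def grad_rotation sym_part_rotation)
  qed
qed

lemma phase_measure:
  assumes "0 < R" "2 * R \<le> \<rho>" "E \<in> wells \<epsilon>"
  shows "measure lebesgue (phase R E) = pi / 3 * R\<^sup>2"
proof -
  define E1 :: "real^2^2" where "E1 = \<epsilon> *\<^sub>R vector [vector [1, 0], vector [0, -1]]"
  define E2 :: "real^2^2" where "E2 = \<epsilon> *\<^sub>R vector [vector [-1/2, sqrt 3 / 2], vector [sqrt 3 / 2, 1/2]]"
  define E3 :: "real^2^2" where "E3 = \<epsilon> *\<^sub>R vector [vector [-1/2, - (sqrt 3 / 2)], vector [- (sqrt 3 / 2), 1/2]]"
  note E = E1_def E2_def E3_def
  have w: "wells \<epsilon> = {E1, E2, E3}" unfolding wells_def E by simp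
  note mat = E Q_def vec_eq_iff forall_2 matrix_matrix_mult_def sum_2 transpose_def r_simps
  have rot: "Q ** E1 ** transpose Q = E3" "Q ** E3 ** transpose Q = E2" "Q ** E2 ** transpose Q = E1"
    by (simp_all add: mat)
  have nz: "E1 \<noteq> 0" "E2 \<noteq> 0" "E3 \<noteq> 0" and ne: "E1 \<noteq> E2" "E1 \<noteq> E3" "E2 \<noteq> E3"
    using eps by (auto simp: E vec_eq_iff forall_2)
  \<comment> \<open>Conjugation by \<open>Q\<close> sends \<open>E1\<close> to \<open>E3\<close>,
    \<open>E3\<close> to \<open>E2\<close> and \<open>E2\<close> to \<open>E1\<close>; the cyclic
    chain of inequalities forces equality.\<close>
  have le: "measure lebesgue (phase R E1) \<le> measure lebesgue (phase R E3)"
    "measure lebesgue (phase R E3) \<le> measure lebesgue (phase R E2)"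
    "measure lebesgue (phase R E2) \<le> measure lebesgue (phase R E1)"
    by (rule phase_rotation_le[OF nz(1), of R, unfolded rot] phase_rotation_le[OF nz(3), of R, unfolded rot]
        phase_rotation_le[OF nz(2), of R, unfolded rot])+
  have eq: "measure lebesgue (phase R E2) = measure lebesgue (phase R E1)"
    "measure lebesgue (phase R E3) = measure lebesgue (phase R E1)"
    by (rule antisym[OF le(3) order_trans[OF le(1,2)]] antisym[OF order_trans[OF le(2,3)] le(1)])+
  \<comment> \<open>The disjoint phases fill the ball up to a null set, since
    \<open>2 * R \<le> \<rho>\<close> places the ball inside the first triangle.\<close>
  have "AE x in lebesgue. (x \<in> phase R E1 \<union> phase R E2 \<union> phase R E3) = (x \<in> ball 0 R)"
    using regular_AE
  proof eventually_elim
    case (elim x)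
    have "sym_part (grad nested x) \<in> {E1, E2, E3}" if "x \<in> ball 0 R"
      unfolding w[symmetric] by (rule nested_strain[OF _ elim]) (use that assms(2) in simp)
    then show ?case unfolding phase_def by blast
  qed
  then have "measure lebesgue (phase R E1 \<union> phase R E2 \<union> phase R E3) = measure lebesgue (ball 0 R :: (real^2) set)"
    using phase_lmeasurable by (intro measure_eq_AE) (auto intro: fmeasurableD)
  moreover have "measure lebesgue (phase R E1 \<union> phase R E2 \<union> phase R E3)
    = measure lebesgue (phase R E1) + measure lebesgue (phase R E2) + measure lebesgue (phase R E3)"
  proof -
    have "measure lebesgue (phase R E1 \<union> phase R E2) = measure lebesgue (phase R E1) + measure lebesgue (phase R E2)"
      by (intro measure_Un_AE phase_lmeasurable always_eventually) (use ne in \<open>auto simp: phase_def\<close>)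
    moreover have "measure lebesgue (phase R E1 \<union> phase R E2 \<union> phase R E3)
      = measure lebesgue (phase R E1 \<union> phase R E2) + measure lebesgue (phase R E3)"
      by (intro measure_Un_AE phase_lmeasurable fmeasurable.Un always_eventually)
        (use ne in \<open>auto simp: phase_def\<close>)
    ultimately show ?thesis by simp
  qed
  ultimately have "3 * measure lebesgue (phase R E1) = R\<^sup>2 * pi"
    using circle_area[of R 0] assms(1) eq by simp
  then have "measure lebesgue (phase R E1) = pi / 3 * R\<^sup>2" by (simp add: field_simps)
  then show ?thesis using assms(3) eq unfolding w by auto
qed

end

theorem theorem1:
  fixes L \<epsilon> R :: real and \<Omega> :: "(real^2) set" and E1 E2 E3 :: "real^2^2"
  assumes "L > 0" and "\<epsilon> > 0"
    and "R = L * sqrt (2/3 + 1 / sqrt 3)"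
    and "\<Omega> = ball 0 R"
    and "E1 = \<epsilon> *\<^sub>R vector [vector [1, 0], vector [0, -1]]"
    and "E2 = \<epsilon> *\<^sub>R vector [vector [-1/2, sqrt 3 / 2], vector [sqrt 3 / 2, 1/2]]"
    and "E3 = \<epsilon> *\<^sub>R vector [vector [-1/2, - (sqrt 3 / 2)], vector [- (sqrt 3 / 2), 1/2]]"
  shows "\<exists>(u :: real^2 \<Rightarrow> real^2) (G :: real^2 \<Rightarrow> real^2^2).
           has_weak_gradient \<Omega> u G \<and>
           continuous_up_to_closure \<Omega> u \<and>
           (AE x in lebesgue_on \<Omega>. sym_part (G x) \<in> {E1, E2, E3}) \<and>
           (\<forall>E\<in>{E1, E2, E3}.
              {x \<in> \<Omega>. sym_part (G x) = E} \<in> sets lebesgue \<and>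
              measure lebesgue {x \<in> \<Omega>. sym_part (G x) = E} = pi / 3 * R\<^sup>2) \<and>
           (\<forall>p\<ge>1. in_W1p p \<Omega> u) \<and>
           \<not> (\<exists>C. C-lipschitz_on \<Omega> u)"
proof -
  have R: "R > 0" using assms(1) unfolding assms(3) by (intro mult_pos_pos) (auto intro: add_pos_pos)
  \<comment> \<open>With \<open>\<rho> = 2 * R\<close> the ball of radius \<open>\<rho> / 2\<close>,
    where the strain is controlled, is exactly \<open>\<Omega>\<close>.\<close>
  interpret nested_stars \<epsilon> "2 * R" by standard (use R assms(2) in auto)
  have w: "{E1, E2, E3} = wells \<epsilon>" unfolding wells_def assms by simp
  have ph: "{x \<in> \<Omega>. sym_part (grad nested x) = E} = phase R E" for E
    unfolding phase_def assms(4) ..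
  have "AE x in lebesgue. x \<in> \<Omega> \<longrightarrow> sym_part (grad nested x) \<in> wells \<epsilon>"
    using regular_AE by eventually_elim (use nested_strain assms(4) in auto)
  then have strain: "AE x in lebesgue_on \<Omega>. sym_part (grad nested x) \<in> {E1, E2, E3}"
    unfolding w assms(4) by (subst AE_restrict_space_iff) auto
  show ?thesis
  proof (intro exI[of _ nested] exI[of _ "grad nested"] conjI strain ballI allI impI)
    show "has_weak_gradient \<Omega> nested (grad nested)" by (rule nested_weak_gradient)
    show "continuous_up_to_closure \<Omega> nested"
      unfolding continuous_up_to_closure_def using continuous_on_subset[OF nested_continuous subset_UNIV] by blast
    show "in_W1p p \<Omega> nested" if "1 \<le> p" for p
      by (rule nested_in_W1p[OF that]) (auto simp: assms(4))
    show "\<not> (\<exists>C. C-lipschitz_on \<Omega> nested)"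
      unfolding assms(4) by (rule nested_not_lipschitz[OF R])
    fix E assume "E \<in> {E1, E2, E3}"
    then have E: "E \<in> wells \<epsilon>" unfolding w .
    show "{x \<in> \<Omega>. sym_part (grad nested x) = E} \<in> sets lebesgue"
      unfolding ph by (rule fmeasurableD[OF phase_lmeasurable])
    show "measure lebesgue {x \<in> \<Omega>. sym_part (grad nested x) = E} = pi / 3 * R\<^sup>2"
      unfolding ph by (rule phase_measure[OF R _ E]) simp
  qed
qed

end
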